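(* Let $\mathbb{K}$ be an infinite field and let $A=\bigoplus_{n\ge0}A_n$ be an affine locally finite $\mathbb{Z}_{\ge0}$-graded $\mathbb{K}$-algebra, equipped with the associated filtration $F_nA=\bigoplus_{k=0}^nA_k$. Give $\mathrm{Aut}_{\mathrm{fl}}A$ and $\mathrm{Aut}_{\mathrm{gr}}A$ their natural affine algebraic group structures. Then any maximal torus of $\mathrm{Aut}_{\mathrm{gr}}A$ is also a maximal torus of $\mathrm{Aut}_{\mathrm{fl}}A$.
   Context: Algebras are unital associative $\mathbb{K}$-algebras; affine means finitely generated as an algebra. A $\mathbb{Z}_{\ge0}$-grading is locally finite if each $A_n$ is finite dimensional over $\mathbb{K}$. $\mathrm{Aut}_{\mathrm{fl}}A$ is the group of $\mathbb{K}$-algebra automorphisms $\phi$ of $A$ with $\phi(F_nA)=F_nA$ for all $n\ge0$, and $\mathrm{Aut}_{\mathrm{gr}}A\subseteq\mathrm{Aut}_{\mathrm{fl}}A$ is the subgroup of those with $\phi(A_n)=A_n$ for all $n\ge0$. Algebraic group structure: choose $d$ such that $F_dA$ generates $A$ as an algebra; restriction to $F_dA$ is an isomorphism of $\mathrm{Aut}_{\mathrm{fl}}A$ onto a Zariski-closed subgroup of $\mathrm{GL}(F_dA)$, and it maps $\mathrm{Aut}_{\mathrm{gr}}A$ onto a Zariski-closed subgroup; the structures transported this way are independent of $d$. A torus of such a group is a closed subgroup isomorphic as an algebraic group to some $(\mathbb{K}^* )^r$; a maximal torus is one maximal under inclusion. *)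

theory Defs
  imports
    "HOL-Library.Function_Algebras"
    "HOL-Algebra.Product_Groups"
    "Jordan_Normal_Form.Determinant"
begin

section \<open>Graded algebras\<close>

text \<open>The sort \<open>{ring, monoid_mult}\<close> is that of unital associative rings in which
  \<open>0 = 1\<close> is not excluded, so the zero algebra is covered.\<close>

locale unital_algebra = vector_space scale
  for scale :: "'k::field \<Rightarrow> 'a::{ring, monoid_mult} \<Rightarrow> 'a" +
  assumes scale_mult_left: "scale c x * y = scale c (x * y)"
    and scale_mult_right: "x * scale c y = scale c (x * y)"

inductive_set generated_algebra :: "('k \<Rightarrow> 'a \<Rightarrow> 'a) \<Rightarrow> 'a::{ring, monoid_mult} set \<Rightarrow> 'a set"
  for scale :: "'k \<Rightarrow> 'a \<Rightarrow> 'a" and S :: "'a set"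
  where
    incl: "x \<in> S \<Longrightarrow> x \<in> generated_algebra scale S"
  | one: "1 \<in> generated_algebra scale S"
  | add: "x \<in> generated_algebra scale S \<Longrightarrow> y \<in> generated_algebra scale S
      \<Longrightarrow> x + y \<in> generated_algebra scale S"
  | mult: "x \<in> generated_algebra scale S \<Longrightarrow> y \<in> generated_algebra scale S
      \<Longrightarrow> x * y \<in> generated_algebra scale S"
  | scale: "x \<in> generated_algebra scale S \<Longrightarrow> scale c x \<in> generated_algebra scale S"

definition affine_algebra :: "('k::field \<Rightarrow> 'a::{ring, monoid_mult} \<Rightarrow> 'a) \<Rightarrow> bool" where
  "affine_algebra scale \<longleftrightarrow> (\<exists>S. finite S \<and> generated_algebra scale S = UNIV)"

locale graded_algebra = unital_algebra scale
  for scale :: "'k::field \<Rightarrow> 'a::{ring, monoid_mult} \<Rightarrow> 'a" +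
  fixes A :: "nat \<Rightarrow> 'a set"
  assumes subspace_component: "subspace (A n)"
    and mult_component: "x \<in> A m \<Longrightarrow> y \<in> A n \<Longrightarrow> x * y \<in> A (m + n)"
    and direct_sum: "\<exists>!c. (\<forall>n. c n \<in> A n) \<and> finite {n. c n \<noteq> 0} \<and> x = (\<Sum>n | c n \<noteq> 0. c n)"

definition locally_finite :: "('k::field \<Rightarrow> 'a::{ring, monoid_mult} \<Rightarrow> 'a) \<Rightarrow> (nat \<Rightarrow> 'a set) \<Rightarrow> bool" where
  "locally_finite scale A \<longleftrightarrow> (\<forall>n. \<exists>B. finite B \<and> module.span scale B = A n)"

definition filtration :: "(nat \<Rightarrow> 'a::comm_monoid_add set) \<Rightarrow> nat \<Rightarrow> 'a set" where
  "filtration A n = {\<Sum>k\<le>n. c k | c. \<forall>k\<le>n. c k \<in> A k}"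


section \<open>Affine algebraic groups, described by their \<open>\<bbbK>\<close>-points and coordinate rings\<close>

text \<open>The field \<open>coord\<close> holds the coordinate ring, as a set of functions of which only the
  values on the carrier matter: it is closed under agreement on the carrier.\<close>

record ('g, 'k) affine_group = "'g monoid" +
  coord :: "('g \<Rightarrow> 'k) set"

definition function_algebra :: "'g set \<Rightarrow> ('g \<Rightarrow> 'k::field) set \<Rightarrow> ('g \<Rightarrow> 'k) set" where
  "function_algebra X S = {f. \<exists>g \<in> generated_algebra (\<lambda>c g x. c * g x) S. \<forall>x\<in>X. f x = g x}"

definition zariski_closed :: "('g, 'k::field) affine_group \<Rightarrow> 'g set \<Rightarrow> bool" where
  "zariski_closed G H \<longleftrightarrow> (\<exists>S \<subseteq> coord G. H = {x \<in> carrier G. \<forall>f\<in>S. f x = 0})"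

definition closed_subgroup :: "'g set \<Rightarrow> ('g, 'k::field) affine_group \<Rightarrow> bool" where
  "closed_subgroup H G \<longleftrightarrow> subgroup H G \<and> zariski_closed G H"

text \<open>The coordinate ring of a closed subgroup is \<open>\<bbbK>[G] / I(H)\<close>, the ring of restrictions to
  \<open>H\<close> of regular functions on \<open>G\<close>.\<close>

definition induced_group :: "('g, 'k::field) affine_group \<Rightarrow> 'g set \<Rightarrow> ('g, 'k) affine_group" where
  "induced_group G H = \<lparr>carrier = H, monoid.mult = monoid.mult G, one = one G,
     coord = {f. \<exists>g \<in> coord G. \<forall>x\<in>H. f x = g x}\<rparr>"

definition algebraic_iso ::
    "('g, 'k::field) affine_group \<Rightarrow> ('h, 'k) affine_group \<Rightarrow> ('g \<Rightarrow> 'h) set" where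
  "algebraic_iso G H = {\<phi> \<in> iso G H.
     (\<forall>f \<in> coord H. f \<circ> \<phi> \<in> coord G) \<and>
     (\<forall>f \<in> coord G. f \<circ> inv_into (carrier G) \<phi> \<in> coord H)}"

definition multiplicative_group :: "'k::field monoid" where
  "multiplicative_group = \<lparr>carrier = UNIV - {0}, monoid.mult = (*), one = 1\<rparr>"

text \<open>\<open>(\<bbbK>\<^sup>*)\<^sup>r\<close>, whose regular functions are the Laurent polynomials in the coordinates.\<close>

definition standard_torus :: "nat \<Rightarrow> (nat \<Rightarrow> 'k, 'k::field) affine_group" where
  "standard_torus r =
     (let G = product_group {..<r} (\<lambda>_. multiplicative_group) in
      \<lparr>carrier = carrier G, monoid.mult = monoid.mult G, one = one G,
       coord = function_algebra (carrier G)
         ((\<lambda>i x. x i) ` {..<r} \<union> (\<lambda>i x. inverse (x i)) ` {..<r})\<rparr>)"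

definition is_torus :: "('g, 'k::field) affine_group \<Rightarrow> 'g set \<Rightarrow> bool" where
  "is_torus G T \<longleftrightarrow> closed_subgroup T G \<and>
     (\<exists>r. algebraic_iso (induced_group G T) (standard_torus r) \<noteq> {})"

definition maximal_torus :: "('g, 'k::field) affine_group \<Rightarrow> 'g set \<Rightarrow> bool" where
  "maximal_torus G T \<longleftrightarrow> is_torus G T \<and> (\<forall>T'. is_torus G T' \<and> T \<subseteq> T' \<longrightarrow> T' = T)"


section \<open>The general linear group of a finite-dimensional subspace\<close>

definition ordered_basis :: "('k::field \<Rightarrow> 'a::ab_group_add \<Rightarrow> 'a) \<Rightarrow> 'a set \<Rightarrow> 'a list \<Rightarrow> bool" where
  "ordered_basis scale V bs \<longleftrightarrow>
     distinct bs \<and> \<not> module.dependent scale (set bs) \<and> module.span scale (set bs) = V"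

definition matrix_of ::
    "('k::field \<Rightarrow> 'a::ab_group_add \<Rightarrow> 'a) \<Rightarrow> 'a list \<Rightarrow> ('a \<Rightarrow> 'a) \<Rightarrow> 'k mat" where
  "matrix_of scale bs \<phi> = mat (length bs) (length bs)
     (\<lambda>(i, j). module.representation scale (set bs) (\<phi> (bs ! j)) (bs ! i))"

text \<open>The coordinate ring of \<open>GL(V)\<close> is generated by the matrix entries and the inverse of the
  determinant. All ordered bases of \<open>V\<close> are admitted, to avoid choosing one; any single basis
  yields the same ring, since a change of basis acts linearly on matrix entries and preserves the
  determinant.\<close>

definition GL :: "('k::field \<Rightarrow> 'a::ab_group_add \<Rightarrow> 'a) \<Rightarrow> 'a set \<Rightarrow> ('a \<Rightarrow> 'a, 'k) affine_group" where
  "GL scale V =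
     (let X = {\<phi> \<in> extensional V. bij_betw \<phi> V V \<and>
                (\<forall>x\<in>V. \<forall>y\<in>V. \<phi> (x + y) = \<phi> x + \<phi> y) \<and>
                (\<forall>c. \<forall>x\<in>V. \<phi> (scale c x) = scale c (\<phi> x))} in
      \<lparr>carrier = X, monoid.mult = compose V, one = restrict id V,
       coord = function_algebra X
         ({\<lambda>\<phi>. matrix_of scale bs \<phi> $$ (i, j) | bs i j.
             ordered_basis scale V bs \<and> i < length bs \<and> j < length bs} \<union>
          {\<lambda>\<phi>. inverse (det (matrix_of scale bs \<phi>)) | bs. ordered_basis scale V bs})\<rparr>)"


section \<open>Automorphism groups\<close>

definition algebra_automorphisms ::
    "('k::field \<Rightarrow> 'a::{ring, monoid_mult} \<Rightarrow> 'a) \<Rightarrow> ('a \<Rightarrow> 'a) set" where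
  "algebra_automorphisms scale = {\<phi>. bij \<phi> \<and> Vector_Spaces.linear scale scale \<phi> \<and>
     (\<forall>x y. \<phi> (x * y) = \<phi> x * \<phi> y) \<and> \<phi> 1 = 1}"

text \<open>The algebraic group structure on a group \<open>X\<close> of automorphisms preserving a subspace \<open>V\<close>,
  transported from \<open>GL(V)\<close> along restriction to \<open>V\<close>. It is used for \<open>V\<close> generating the algebra,
  where restriction is injective on \<open>X\<close>, and for \<open>X\<close> with Zariski-closed image.\<close>

definition restriction_group ::
    "('k::field \<Rightarrow> 'a::ab_group_add \<Rightarrow> 'a) \<Rightarrow> 'a set \<Rightarrow> ('a \<Rightarrow> 'a) set \<Rightarrow> ('a \<Rightarrow> 'a, 'k) affine_group" where
  "restriction_group scale V X = \<lparr>carrier = X, monoid.mult = (\<circ>), one = id,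
     coord = {f. \<exists>g \<in> coord (GL scale V). \<forall>\<phi>\<in>X. f \<phi> = g (restrict \<phi> V)}\<rparr>"

definition Aut_fl ::
    "('k::field \<Rightarrow> 'a::{ring, monoid_mult} \<Rightarrow> 'a) \<Rightarrow> (nat \<Rightarrow> 'a set) \<Rightarrow> nat
      \<Rightarrow> ('a \<Rightarrow> 'a, 'k) affine_group" where
  "Aut_fl scale A d = restriction_group scale (filtration A d)
     {\<phi> \<in> algebra_automorphisms scale. \<forall>n. \<phi> ` filtration A n = filtration A n}"

definition Aut_gr ::
    "('k::field \<Rightarrow> 'a::{ring, monoid_mult} \<Rightarrow> 'a) \<Rightarrow> (nat \<Rightarrow> 'a set) \<Rightarrow> nat
      \<Rightarrow> ('a \<Rightarrow> 'a, 'k) affine_group" where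
  "Aut_gr scale A d = restriction_group scale (filtration A d)
     {\<phi> \<in> algebra_automorphisms scale. \<forall>n. \<phi> ` A n = A n}"

text \<open>A degree \<open>d\<close> as used in the definition of the algebraic group structures always exists.\<close>

lemma generated_algebra_mono:
  assumes "S \<subseteq> T"
  shows "generated_algebra scale S \<subseteq> generated_algebra scale T"
proof
  fix x assume "x \<in> generated_algebra scale S"
  then show "x \<in> generated_algebra scale T"
    by induction (use assms in \<open>auto intro: generated_algebra.intros\<close>)
qed

context graded_algebra
begin

lemma filtration_mono:
  assumes "m \<le> n"
  shows "filtration A m \<subseteq> filtration A n"
proof
  fix x assume "x \<in> filtration A m"
  then obtain c where c: "\<forall>k\<le>m. c k \<in> A k" "x = (\<Sum>k\<le>m. c k)"
    unfolding filtration_def by auto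
  define c' where "c' k = (if k \<le> m then c k else 0)" for k
  have "x = (\<Sum>k\<le>n. c' k)"
    unfolding c(2) c'_def using assms by (intro sum.mono_neutral_cong_left) auto
  moreover have "c' k \<in> A k" for k
    using c(1) subspace_0[OF subspace_component] by (simp add: c'_def)
  ultimately show "x \<in> filtration A n"
    unfolding filtration_def by blast
qed

lemma in_filtration: "\<exists>n. x \<in> filtration A n"
proof -
  obtain c where c: "\<forall>n. c n \<in> A n" "finite {n. c n \<noteq> 0}" "x = (\<Sum>n | c n \<noteq> 0. c n)"
    using direct_sum[of x] by blast
  obtain N where N: "\<forall>n\<in>{n. c n \<noteq> 0}. n \<le> N"
    using c(2) by (meson finite_nat_set_iff_bounded_le)
  have "x = (\<Sum>n\<le>N. c n)"
    unfolding c(3) using N by (intro sum.mono_neutral_left) auto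
  with c(1) show ?thesis
    unfolding filtration_def by blast
qed

lemma filtration_generates:
  assumes "affine_algebra scale"
  shows "\<exists>d. generated_algebra scale (filtration A d) = UNIV"
proof -
  obtain S where S: "finite S" "generated_algebra scale S = UNIV"
    using assms unfolding affine_algebra_def by blast
  obtain m where m: "\<And>x. x \<in> filtration A (m x)"
    using in_filtration by metis
  obtain d where d: "\<forall>x\<in>S. m x \<le> d"
    using S(1) by (metis finite_imageI finite_nat_set_iff_bounded_le imageI)
  have "S \<subseteq> filtration A d"
    using d m filtration_mono by blast
  then show ?thesis
    using generated_algebra_mono S(2) by blast
qed

end

end

theory Submission
  imports Defs
begin

text \<open>For \<open>q \<noteq> 0\<close> let \<open>\<tau> q\<close> be the automorphism acting on \<open>A n\<close> as \<open>q\<^sup>n\<close>. Since the field is infinite,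
  the centralizer of all \<open>\<tau> q\<close> in the automorphism group is exactly the group of graded
  automorphisms. So if a maximal torus \<open>T\<close> of the graded group contains all \<open>\<tau> q\<close>, then every torus of
  the filtered group that contains \<open>T\<close> is commutative, hence graded, hence equal to \<open>T\<close>.

  That \<open>T\<close> contains all \<open>\<tau> q\<close> follows from maximality, once a graded torus containing both \<open>T\<close> and
  all \<open>\<tau> q\<close> is found. The image of \<open>T \<times> \<tau>\<close> need not be closed on points over a field that is not
  algebraically closed (the squares in the real numbers are not), so the torus is instead obtained from
  the lattice generated by the weights of \<open>T \<times> \<tau>\<close> on a homogeneous weight basis of the generating
  subspace.\<close>

section \<open>Laurent monomials on the standard torus\<close>

text \<open>Everything rests on one integral criterion. A family of automorphisms that is diagonal
  in a basis of the generating subspace, with weights in Z^r, is a torus of rank r once the weights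
  generate Z^r itself, not merely a sublattice of finite index: the parameters are then Laurent
  monomials in the eigenvalues, so equations for the image and the inverse morphism can be written
  down without extracting roots. Conversely, the weights of a torus of the graded group always
  generate. Both facts are expressed by an integer left inverse of the weight matrix. The obstacle
  lies in enlarging \<open>T\<close>. Corrected by a one-parameter subgroup of \<open>T\<close>, the
  degree scaling by \<open>q\<close> acts on the j-th basis vector as \<open>q^(k j)\<close>, and
  the \<open>k j\<close> may have a common divisor \<open>m\<close>. The larger torus needs
  automorphisms acting as \<open>s^(k j / m)\<close> for every nonzero \<open>s\<close>, also when
  \<open>s\<close> is no m-th power, and compositions of the known automorphisms need not provide
  them. They come from reading the eigenspaces of the known automorphisms as a grading by the
  integers and rescaling that grading by an arbitrary \<open>s\<close>.\<close>

text \<open>Dedekind's independence of characters, with vectors as coefficients so that it compares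
  expansions of algebra elements as well as of functions. The product \<open>f\<close> on
  \<open>M\<close> will be that of torus points or of nonzero scalars. At \<open>u\<close> no
  character vanishes, which cancels the last remaining term.\<close>

lemma (in vector_space) characters_independent:
  assumes "finite F" and u: "u \<in> M" "\<And>i. i \<in> F \<Longrightarrow> \<chi> i u \<noteq> 0"
    and closed: "\<And>s t. s \<in> M \<Longrightarrow> t \<in> M \<Longrightarrow> f s t \<in> M"
    and hom: "\<And>i s t. i \<in> F \<Longrightarrow> s \<in> M \<Longrightarrow> t \<in> M \<Longrightarrow> \<chi> i (f s t) = \<chi> i s * \<chi> i t"
    and distinct: "\<And>i j. i \<in> F \<Longrightarrow> j \<in> F \<Longrightarrow> i \<noteq> j \<Longrightarrow> \<exists>s\<in>M. \<chi> i s \<noteq> \<chi> j s"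
    and zero: "\<And>t. t \<in> M \<Longrightarrow> (\<Sum>i\<in>F. scale (\<chi> i t) (v i)) = 0"
    and "i \<in> F"
  shows "v i = 0"
  using assms(1) u(2) hom distinct zero \<open>i \<in> F\<close>
proof (induction F arbitrary: v i rule: finite_induct)
  case (insert a F)
  have *: "v i = 0" if i: "i \<in> F" for i
  proof -
    from i insert.hyps have "i \<noteq> a" by auto
    then obtain s where s: "s \<in> M" "\<chi> i s \<noteq> \<chi> a s"
      using insert.prems(3)[of i a] i by auto
    \<comment> \<open>The relation at \<open>f s t\<close> minus \<open>\<chi> a s\<close> times the
      relation at \<open>t\<close> has no \<open>a\<close>-term; a relation over \<open>F\<close>
      with rescaled vectors remains.\<close>
    have "(\<Sum>j\<in>F. scale (\<chi> j t) (scale (\<chi> j s - \<chi> a s) (v j))) = 0" if t: "t \<in> M" for t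
    proof -
      have "(\<Sum>j\<in>insert a F. scale (\<chi> j (f s t)) (v j)) = 0"
        using insert.prems(4) closed s(1) t by blast
      moreover have "scale (\<chi> a s) (\<Sum>j\<in>insert a F. scale (\<chi> j t) (v j)) = 0"
        using insert.prems(4)[OF t] by simp
      ultimately have "(\<Sum>j\<in>insert a F. scale (\<chi> j (f s t)) (v j) - scale (\<chi> a s) (scale (\<chi> j t) (v j))) = 0"
        by (simp add: sum_subtractf scale_sum_right)
      moreover have "scale (\<chi> j (f s t)) (v j) - scale (\<chi> a s) (scale (\<chi> j t) (v j))
          = scale (\<chi> j t) (scale (\<chi> j s - \<chi> a s) (v j))" if "j \<in> insert a F" for j
        using insert.prems(2)[OF that s(1) t] by (simp add: algebra_simps scale_left_diff_distrib)
      ultimately have "(\<Sum>j\<in>insert a F. scale (\<chi> j t) (scale (\<chi> j s - \<chi> a s) (v j))) = 0"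
        by simp
      then show ?thesis using insert.hyps by simp
    qed
    then have "scale (\<chi> i s - \<chi> a s) (v i) = 0"
      using insert.IH[where v = "\<lambda>j. scale (\<chi> j s - \<chi> a s) (v j)" and i = i] insert.prems(1-3) i by blast
    then show ?thesis using s(2) by simp
  qed
  have "scale (\<chi> a u) (v a) = 0"
    using insert.prems(4)[OF u(1)] insert.hyps * by simp
  then have "v a = 0" using insert.prems(1)[of a] by simp
  then show ?case using * insert.prems(5) by auto
qed simp

section \<open>Integer powers over an infinite field\<close>

lemma field_vector_space: "vector_space ((*) :: 'k::field \<Rightarrow> 'k \<Rightarrow> 'k)"
  by unfold_locales (auto simp: algebra_simps)

lemma finite_roots_of_unity:
  fixes n :: int
  assumes "n \<noteq> 0"
  shows "finite {x :: 'k::field. x powi n = 1}"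
proof -
  have "{x :: 'k. x powi n = 1} \<subseteq> {x. x ^ nat \<bar>n\<bar> = 1}"
  proof clarsimp
    fix x :: 'k assume "x powi n = 1"
    then show "x ^ nat \<bar>n\<bar> = 1"
      by (cases "n \<ge> 0") (auto simp: power_int_def power_inverse)
  qed
  moreover have "finite {x :: 'k. x ^ nat \<bar>n\<bar> = 1}"
  proof -
    let ?p = "Polynomial.monom (1::'k) (nat \<bar>n\<bar>) - 1"
    have "Polynomial.coeff ?p (nat \<bar>n\<bar>) \<noteq> 0"
      using assms by simp
    then have "?p \<noteq> 0" by (metis Polynomial.coeff_0)
    then have "finite {x. poly ?p x = 0}" by (rule poly_roots_finite)
    then show ?thesis by (simp add: poly_monom)
  qed
  ultimately show ?thesis by (rule finite_subset)
qed

text \<open>Here the infinite field enters: \<open>x powi (m - n) = 1\<close> has only finitely many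
  solutions. Every later separation of weights or degrees reduces to this.\<close>

lemma powi_separates:
  fixes m n :: int
  assumes "infinite (UNIV :: 'k::field set)" "m \<noteq> n"
  shows "\<exists>x :: 'k. x \<noteq> 0 \<and> x powi m \<noteq> x powi n"
proof -
  have "finite (insert 0 {x :: 'k. x powi (m - n) = 1})"
    using finite_roots_of_unity[of "m - n"] assms(2) by simp
  then obtain x :: 'k where "x \<noteq> 0" "x powi (m - n) \<noteq> 1"
    using assms(1) ex_new_if_finite by blast
  then show ?thesis
    by (auto intro!: exI[of _ x] simp: power_int_diff)
qed

lemma powi_prod: "(\<Prod>i\<in>I. f i :: 'k::field) powi m = (\<Prod>i\<in>I. f i powi m)"
  by (induction I rule: infinite_finite_induct) (simp_all add: power_int_mult_distrib)

lemma powi_sum: "x \<noteq> 0 \<Longrightarrow> (x :: 'k::field) powi (\<Sum>i\<in>I. f i) = (\<Prod>i\<in>I. x powi f i)"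
  by (induction I rule: infinite_finite_induct) (simp_all add: power_int_add)

section \<open>Points and characters of the standard torus\<close>

definition torus_points :: "nat \<Rightarrow> (nat \<Rightarrow> 'k::field) set" where
  "torus_points r = (\<Pi>\<^sub>E i\<in>{..<r}. UNIV - {0})"

definition torus_mult :: "nat \<Rightarrow> (nat \<Rightarrow> 'k::field) \<Rightarrow> (nat \<Rightarrow> 'k) \<Rightarrow> nat \<Rightarrow> 'k" where
  "torus_mult r x y = (\<lambda>i\<in>{..<r}. x i * y i)"

definition torus_one :: "nat \<Rightarrow> nat \<Rightarrow> 'k::field" where
  "torus_one r = (\<lambda>i\<in>{..<r}. 1)"

definition torus_inv :: "nat \<Rightarrow> (nat \<Rightarrow> 'k::field) \<Rightarrow> nat \<Rightarrow> 'k" where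
  "torus_inv r x = (\<lambda>i\<in>{..<r}. inverse (x i))"

lemma standard_torus_simps:
  "carrier (standard_torus r) = torus_points r"
  "monoid.mult (standard_torus r) = torus_mult r"
  "one (standard_torus r) = torus_one r"
  by (auto simp: standard_torus_def Let_def torus_points_def torus_mult_def torus_one_def
      multiplicative_group_def fun_eq_iff)

lemma torus_points_nonzero: "t \<in> torus_points r \<Longrightarrow> i < r \<Longrightarrow> t i \<noteq> 0"
  by (auto simp: torus_points_def PiE_iff)

lemma torus_points_eqI:
  "s \<in> torus_points r \<Longrightarrow> t \<in> torus_points r \<Longrightarrow> (\<And>i. i < r \<Longrightarrow> s i = t i) \<Longrightarrow> s = t"
  unfolding torus_points_def by (rule PiE_ext) auto

lemma restrict_torus_points: "(\<And>i. i < r \<Longrightarrow> f i \<noteq> 0) \<Longrightarrow> restrict f {..<r} \<in> torus_points r"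
  by (auto simp: torus_points_def)

lemma torus_closed [simp, intro]:
  "torus_one r \<in> torus_points r"
  "s \<in> torus_points r \<Longrightarrow> t \<in> torus_points r \<Longrightarrow> torus_mult r s t \<in> torus_points r"
  "s \<in> torus_points r \<Longrightarrow> torus_inv r s \<in> torus_points r"
  by (auto simp: torus_one_def torus_mult_def torus_inv_def torus_points_nonzero
      intro!: restrict_torus_points)

lemma torus_mult_inv: "s \<in> torus_points r \<Longrightarrow> torus_mult r s (torus_inv r s) = torus_one r"
  by (auto simp: torus_one_def torus_mult_def torus_inv_def torus_points_nonzero fun_eq_iff)

lemma torus_mult_commute: "torus_mult r s t = torus_mult r t s"
  by (auto simp: torus_mult_def fun_eq_iff)

definition laurent_monomial :: "nat \<Rightarrow> (nat \<Rightarrow> int) \<Rightarrow> (nat \<Rightarrow> 'k::field) \<Rightarrow> 'k" where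
  "laurent_monomial r e t = (\<Prod>i<r. t i powi e i)"

lemma laurent_monomial_nonzero: "t \<in> torus_points r \<Longrightarrow> laurent_monomial r e t \<noteq> 0"
  by (auto simp: laurent_monomial_def torus_points_nonzero)

lemma laurent_monomial_mult:
  "laurent_monomial r e (torus_mult r s t) = laurent_monomial r e s * laurent_monomial r e t"
  by (simp add: laurent_monomial_def torus_mult_def power_int_mult_distrib prod.distrib)

lemma laurent_monomial_one [simp]: "laurent_monomial r e (torus_one r) = 1"
  by (simp add: laurent_monomial_def torus_one_def)

lemma laurent_monomial_zero [simp]: "laurent_monomial r 0 t = 1" "laurent_monomial r (\<lambda>_. 0) t = 1"
  by (simp_all add: laurent_monomial_def)

lemma laurent_monomial_uminus: "laurent_monomial r (- e) t = inverse (laurent_monomial r e t)"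
  by (simp add: laurent_monomial_def power_int_minus prod_inversef[symmetric])

lemma laurent_monomial_add:
  "t \<in> torus_points r \<Longrightarrow> laurent_monomial r (e + f) t = laurent_monomial r e t * laurent_monomial r f t"
  by (auto simp: laurent_monomial_def prod.distrib[symmetric] torus_points_nonzero
      intro!: prod.cong power_int_add)

text \<open>A monomial sees only the first \<open>r\<close> entries of a function on
  \<open>nat\<close>. Zeros from \<open>r\<close> on make distinct exponent vectors give distinct
  monomials over an infinite field.\<close>

definition exponents :: "nat \<Rightarrow> (nat \<Rightarrow> int) set" where
  "exponents r = {e. \<forall>i\<ge>r. e i = 0}"

lemma exponents_closed: "0 \<in> exponents r" "e \<in> exponents r \<Longrightarrow> f \<in> exponents r \<Longrightarrow> e + f \<in> exponents r"
  by (auto simp: exponents_def)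

lemma laurent_monomials_distinct:
  assumes "infinite (UNIV :: 'k::field set)" "e \<in> exponents r" "f \<in> exponents r" "e \<noteq> f"
  shows "\<exists>t \<in> torus_points r. laurent_monomial r e (t :: nat \<Rightarrow> 'k) \<noteq> laurent_monomial r f t"
proof -
  obtain i where i: "e i \<noteq> f i" using assms(4) by (auto simp: fun_eq_iff)
  with assms(2,3) have "i < r" by (force simp: exponents_def not_le[symmetric])
  obtain x :: 'k where x: "x \<noteq> 0" "x powi e i \<noteq> x powi f i"
    using powi_separates[OF assms(1) i] by blast
  \<comment> \<open>On the subgroup where only coordinate \<open>i\<close> varies, a monomial is the
    power of \<open>x\<close> given by its \<open>i\<close>-th exponent.\<close>
  let ?t = "\<lambda>j\<in>{..<r}. if j = i then x else 1"
  have *: "laurent_monomial r g ?t = x powi g i" for g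
  proof -
    have "laurent_monomial r g ?t = (\<Prod>j<r. if j = i then x powi g i else 1)"
      unfolding laurent_monomial_def by (intro prod.cong) auto
    then show ?thesis using \<open>i < r\<close> by simp
  qed
  have "?t \<in> torus_points r"
    using x(1) by (intro restrict_torus_points) auto
  with x(2) show ?thesis
    unfolding *[symmetric] by blast
qed

lemma (in vector_space) laurent_monomials_independent:
  assumes "infinite (UNIV :: 'a set)" "finite F" "F \<subseteq> exponents r"
    and "\<And>t. t \<in> torus_points r \<Longrightarrow> (\<Sum>e\<in>F. scale (laurent_monomial r e t) (v e)) = 0"
    and "e \<in> F"
  shows "v e = 0"
  by (rule characters_independent[OF assms(2), of "torus_one r" "torus_points r" "laurent_monomial r" "torus_mult r"])
    (use assms laurent_monomials_distinct[OF assms(1), of _ r] in \<open>auto simp: laurent_monomial_mult subset_iff\<close>)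

section \<open>Spans of Laurent monomials and the coordinate ring of the torus\<close>

text \<open>Two choices of \<open>W\<close> matter: all of \<open>exponents r\<close> yields the
  coordinate ring of the torus, and the lattice spanned by the weights of a representation yields
  the ring that contains the pullbacks of regular functions.\<close>

definition laurent_span :: "nat \<Rightarrow> (nat \<Rightarrow> int) set \<Rightarrow> ((nat \<Rightarrow> 'k::field) \<Rightarrow> 'k) set" where
  "laurent_span r W = {f. \<exists>F c. finite F \<and> F \<subseteq> W \<and>
     (\<forall>t\<in>torus_points r. f t = (\<Sum>e\<in>F. c e * laurent_monomial r e t))}"

lemma laurent_span_cong:
  "f \<in> laurent_span r W \<Longrightarrow> (\<And>t. t \<in> torus_points r \<Longrightarrow> g t = f t) \<Longrightarrow> g \<in> laurent_span r W"
  by (auto simp: laurent_span_def)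

lemma laurent_span_monomial:
  assumes "e \<in> W"
  shows "(\<lambda>t. c * laurent_monomial r e t) \<in> laurent_span r W"
  unfolding laurent_span_def
  by (rule CollectI, rule exI[of _ "{e}"], rule exI[of _ "\<lambda>_. c"]) (use assms in auto)

lemma laurent_span_add:
  assumes "f \<in> laurent_span r W" "g \<in> laurent_span r W"
  shows "(\<lambda>t. f t + g t) \<in> laurent_span r W"
proof -
  obtain F c where F: "finite F" "F \<subseteq> W" "\<And>t. t \<in> torus_points r \<Longrightarrow> f t = (\<Sum>e\<in>F. c e * laurent_monomial r e t)"
    using assms(1) by (auto simp: laurent_span_def)
  obtain G b where G: "finite G" "G \<subseteq> W" "\<And>t. t \<in> torus_points r \<Longrightarrow> g t = (\<Sum>e\<in>G. b e * laurent_monomial r e t)"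
    using assms(2) by (auto simp: laurent_span_def)
  let ?c = "\<lambda>e. (if e \<in> F then c e else 0) + (if e \<in> G then b e else 0)"
  have "f t + g t = (\<Sum>e\<in>F \<union> G. ?c e * laurent_monomial r e t)" if "t \<in> torus_points r" for t
  proof -
    have "f t = (\<Sum>e\<in>F \<union> G. (if e \<in> F then c e else 0) * laurent_monomial r e t)"
      unfolding F(3)[OF that] using F(1) G(1) by (intro sum.mono_neutral_cong_left) auto
    moreover have "g t = (\<Sum>e\<in>F \<union> G. (if e \<in> G then b e else 0) * laurent_monomial r e t)"
      unfolding G(3)[OF that] using F(1) G(1) by (intro sum.mono_neutral_cong_left) auto
    ultimately show ?thesis
      by (simp add: sum.distrib[symmetric] distrib_right)
  qed
  then show ?thesis unfolding laurent_span_def using F G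
    by (intro CollectI exI[of _ "F \<union> G"] exI[of _ ?c]) auto
qed

lemma laurent_span_zero: "(\<lambda>t. 0) \<in> laurent_span r W"
  unfolding laurent_span_def by (rule CollectI, rule exI[of _ "{}"]) auto

lemma laurent_span_sum:
  "(\<And>i. i \<in> I \<Longrightarrow> f i \<in> laurent_span r W) \<Longrightarrow> (\<lambda>t. \<Sum>i\<in>I. f i t) \<in> laurent_span r W"
  by (induction I rule: infinite_finite_induct) (auto simp: laurent_span_zero laurent_span_add)

lemma laurent_span_mult:
  assumes "f \<in> laurent_span r W" "g \<in> laurent_span r W"
    and W: "\<And>e h. e \<in> W \<Longrightarrow> h \<in> W \<Longrightarrow> e + h \<in> W"
  shows "(\<lambda>t. f t * g t) \<in> laurent_span r W"
proof -
  obtain F c where F: "finite F" "F \<subseteq> W" "\<And>t. t \<in> torus_points r \<Longrightarrow> f t = (\<Sum>e\<in>F. c e * laurent_monomial r e t)"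
    using assms(1) by (auto simp: laurent_span_def)
  obtain G b where G: "finite G" "G \<subseteq> W" "\<And>t. t \<in> torus_points r \<Longrightarrow> g t = (\<Sum>e\<in>G. b e * laurent_monomial r e t)"
    using assms(2) by (auto simp: laurent_span_def)
  have "(\<lambda>t. \<Sum>e\<in>F. \<Sum>h\<in>G. (c e * b h) * laurent_monomial r (e + h) t) \<in> laurent_span r W"
    using F(2) G(2) W by (intro laurent_span_sum laurent_span_monomial) blast
  then show ?thesis
    by (rule laurent_span_cong)
      (simp only: F(3) G(3) sum_product, simp add: laurent_monomial_add mult_ac)
qed

lemma laurent_span_const:
  assumes "0 \<in> W"
  shows "(\<lambda>t. c) \<in> laurent_span r W"
  using laurent_span_monomial[OF assms, of c r] by simp

lemma laurent_span_prod:
  assumes "\<And>i. i \<in> I \<Longrightarrow> f i \<in> laurent_span r W"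
    and "0 \<in> W" "\<And>e h. e \<in> W \<Longrightarrow> h \<in> W \<Longrightarrow> e + h \<in> W"
  shows "(\<lambda>t. \<Prod>i\<in>I. f i t) \<in> laurent_span r W"
  using assms(1)
  by (induction I rule: infinite_finite_induct)
    (auto intro!: laurent_span_const laurent_span_mult assms(2,3))

text \<open>For \<open>e\<close> outside \<open>W\<close> the expansion would be a nontrivial linear
  relation between distinct monomials. This converts membership in a function ring into membership
  in a lattice.\<close>

lemma laurent_monomial_in_span_iff:
  assumes "infinite (UNIV :: 'k::field set)" "W \<subseteq> exponents r" "e \<in> exponents r"
    and "(laurent_monomial r e :: (nat \<Rightarrow> 'k) \<Rightarrow> 'k) \<in> laurent_span r W"
  shows "e \<in> W"
proof (rule ccontr)
  assume "e \<notin> W"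
  obtain F and c :: "_ \<Rightarrow> 'k" where F: "finite F" "F \<subseteq> W"
      "\<And>t. t \<in> torus_points r \<Longrightarrow> laurent_monomial r e t = (\<Sum>e\<in>F. c e * laurent_monomial r e t)"
    using assms(4) by (auto simp: laurent_span_def)
  interpret vector_space "(*) :: 'k \<Rightarrow> 'k \<Rightarrow> 'k" by (rule field_vector_space)
  have "e \<notin> F" using F(2) \<open>e \<notin> W\<close> by auto
  \<comment> \<open>The coefficient \<open>-1\<close> brings the monomial itself into the relation;
    independence then yields the absurd \<open>-1 = 0\<close>.\<close>
  have "(c(e := -1)) e = 0"
  proof (rule laurent_monomials_independent[where F = "insert e F" and r = r and v = "c(e := -1)", OF assms(1)])
    fix t :: "nat \<Rightarrow> 'k" assume t: "t \<in> torus_points r"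
    have "(\<Sum>h\<in>F. laurent_monomial r h t * (c(e := - 1)) h) = (\<Sum>h\<in>F. c h * laurent_monomial r h t)"
      by (rule sum.cong) (use \<open>e \<notin> F\<close> in auto)
    then show "(\<Sum>h\<in>insert e F. laurent_monomial r h t * (c(e := - 1)) h) = 0"
      using F(1) \<open>e \<notin> F\<close> F(3)[OF t] by simp
  qed (use F assms(2,3) in auto)
  then show False by simp
qed

text \<open>The generators are monomials with a single exponent 1 or -1, and exponents add under
  multiplication. Unlike the inductively generated ring, the explicit expansions have coefficients
  that can be compared.\<close>

lemma coord_standard_torus: "coord (standard_torus r :: (nat \<Rightarrow> 'k::field, 'k) affine_group) = laurent_span r (exponents r)"
proof -
  define S where "S = (\<lambda>i x. x i) ` {..<r} \<union> (\<lambda>i (x :: nat \<Rightarrow> 'k). inverse (x i)) ` {..<r}"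
  let ?alg = "generated_algebra (\<lambda>c (g :: (nat \<Rightarrow> 'k) \<Rightarrow> 'k) x. c * g x) S"
  have coord: "coord (standard_torus r) = function_algebra (torus_points r) S"
    by (simp add: standard_torus_def Let_def S_def torus_points_def multiplicative_group_def)
  have unit: "(\<lambda>t :: nat \<Rightarrow> 'k. laurent_monomial r (\<lambda>j. if j = i then n else 0) t) = (\<lambda>t. t i powi n)" if "i < r" for i n
  proof
    fix t :: "nat \<Rightarrow> 'k"
    have "laurent_monomial r (\<lambda>j. if j = i then n else 0) t = (\<Prod>j<r. if j = i then t j powi n else 1)"
      unfolding laurent_monomial_def by (intro prod.cong) auto
    then show "laurent_monomial r (\<lambda>j. if j = i then n else 0) t = t i powi n"
      using that by simp
  qed
  have "f \<in> laurent_span r (exponents r)" if "f \<in> ?alg" for f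
    using that
  proof induction
    case (incl f)
    then obtain i n where "i < r" "f = (\<lambda>t. t i powi n)"
      unfolding S_def by (fastforce intro: that[of _ 1] that[of _ "-1"] simp: power_int_minus)
    moreover from \<open>i < r\<close> have
      "(\<lambda>t :: nat \<Rightarrow> 'k. 1 * laurent_monomial r (\<lambda>j. if j = i then n else 0) t) \<in> laurent_span r (exponents r)"
      by (intro laurent_span_monomial) (auto simp: exponents_def)
    ultimately show ?case
      by (simp add: unit)
  next
    case one
    then show ?case using laurent_span_const[of "exponents r" 1 r] exponents_closed by (simp add: one_fun_def)
  next
    case (add f g)
    then show ?case using laurent_span_add[of f r _ g] by (simp add: plus_fun_def)
  next
    case (mult f g)
    then show ?case using laurent_span_mult[of f r "exponents r" g] exponents_closed by (simp add: times_fun_def)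
  next
    case (scale f c)
    then show ?case 
      using laurent_span_mult[OF laurent_span_const, of "exponents r" f r c] exponents_closed by blast
  qed
  then have "coord (standard_torus r) \<subseteq> (laurent_span r (exponents r) :: ((nat \<Rightarrow> 'k) \<Rightarrow> 'k) set)"
    unfolding coord function_algebra_def by (auto intro: laurent_span_cong)
  moreover have "(laurent_span r (exponents r) :: ((nat \<Rightarrow> 'k) \<Rightarrow> 'k) set) \<subseteq> coord (standard_torus r)"
  proof
    fix f :: "(nat \<Rightarrow> 'k) \<Rightarrow> 'k" assume "f \<in> laurent_span r (exponents r)"
    then obtain F c where F: "finite F"
      "\<And>t. t \<in> torus_points r \<Longrightarrow> f t = (\<Sum>e\<in>F. c e * laurent_monomial r e t)"
      by (auto simp: laurent_span_def)
    have const: "(\<lambda>_. b) \<in> ?alg" for b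
      using generated_algebra.scale[OF generated_algebra.one, of "\<lambda>c (g :: (nat \<Rightarrow> 'k) \<Rightarrow> 'k) x. c * g x" b S]
      by (simp add: one_fun_def)
    have add: "(\<lambda>t. f t + g t) \<in> ?alg" if "f \<in> ?alg" "g \<in> ?alg" for f g
      using generated_algebra.add[OF that] by (simp add: plus_fun_def)
    have mult: "(\<lambda>t. f t * g t) \<in> ?alg" if "f \<in> ?alg" "g \<in> ?alg" for f g
      using generated_algebra.mult[OF that] by (simp add: times_fun_def)
    have pow: "(\<lambda>t. f t ^ n) \<in> ?alg" if "f \<in> ?alg" for f n
      by (induction n) (auto intro: const mult that)
    have powi: "(\<lambda>t. t i powi n) \<in> ?alg" if "i < r" for i n
    proof (cases "n \<ge> 0")
      case True
      have "(\<lambda>t. t i ^ nat n) \<in> ?alg"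
        by (rule pow, rule generated_algebra.incl) (use that in \<open>auto simp: S_def\<close>)
      with True show ?thesis by (simp add: power_int_def)
    next
      case False
      have "(\<lambda>t. inverse (t i) ^ nat (- n)) \<in> ?alg"
        by (rule pow, rule generated_algebra.incl) (use that in \<open>auto simp: S_def\<close>)
      with False show ?thesis by (simp add: power_int_def)
    qed
    have prod: "(\<lambda>t. \<Prod>i\<in>I. g i t) \<in> ?alg" if "\<And>i. i \<in> I \<Longrightarrow> g i \<in> ?alg" for g and I :: "nat set"
      using that by (induction I rule: infinite_finite_induct) (auto intro: const mult)
    have sum: "(\<lambda>t. \<Sum>i\<in>I. g i t) \<in> ?alg" if "\<And>i. i \<in> I \<Longrightarrow> g i \<in> ?alg" for g and I :: "(nat \<Rightarrow> int) set"
      using that by (induction I rule: infinite_finite_induct) (auto intro: const add)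
    have "(\<lambda>t. \<Sum>e\<in>F. c e * laurent_monomial r e t) \<in> ?alg"
      unfolding laurent_monomial_def by (intro sum mult const prod powi) auto
    then show "f \<in> coord (standard_torus r)"
      unfolding coord function_algebra_def using F(2) by auto
  qed
  ultimately show ?thesis by blast
qed

section \<open>Gradings and automorphisms\<close>

context unital_algebra
begin

lemma automorphismD:
  assumes "\<phi> \<in> algebra_automorphisms scale"
  shows "bij \<phi>" "\<phi> (x + y) = \<phi> x + \<phi> y" "\<phi> (scale c x) = scale c (\<phi> x)"
    "\<phi> (x * y) = \<phi> x * \<phi> y" "\<phi> 1 = 1" "\<phi> 0 = 0" "\<phi> (x - y) = \<phi> x - \<phi> y"
    "\<phi> (sum f I) = (\<Sum>i\<in>I. \<phi> (f i))" "Vector_Spaces.linear scale scale \<phi>"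
proof -
  interpret Vector_Spaces.linear scale scale \<phi>
    using assms by (simp add: algebra_automorphisms_def)
  show "bij \<phi>" "\<phi> (x + y) = \<phi> x + \<phi> y" "\<phi> (scale c x) = scale c (\<phi> x)"
    "\<phi> (x * y) = \<phi> x * \<phi> y" "\<phi> 1 = 1" "\<phi> 0 = 0" "\<phi> (x - y) = \<phi> x - \<phi> y"
    "\<phi> (sum f I) = (\<Sum>i\<in>I. \<phi> (f i))" "Vector_Spaces.linear scale scale \<phi>"
    using assms linear_axioms by (auto simp: algebra_automorphisms_def add scale zero diff sum)
qed

text \<open>Preservation of \<open>1\<close> is automatic, since the image of \<open>1\<close> is a unit element for the image of \<open>\<phi>\<close>.\<close>

lemma automorphismI:
  assumes "bij \<phi>" "\<And>x y. \<phi> (x + y) = \<phi> x + \<phi> y" "\<And>c x. \<phi> (scale c x) = scale c (\<phi> x)"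
    and mult: "\<And>x y. \<phi> (x * y) = \<phi> x * \<phi> y"
  shows "\<phi> \<in> algebra_automorphisms scale"
proof -
  have "Vector_Spaces.linear scale scale \<phi>"
    by unfold_locales (use assms in auto)
  moreover obtain y where "\<phi> y = 1"
    using assms(1) by (metis bij_pointE)
  then have "\<phi> 1 = 1"
    using mult[of 1 y] by simp
  ultimately show ?thesis
    using assms by (simp add: algebra_automorphisms_def)
qed

lemma automorphism_id: "id \<in> algebra_automorphisms scale"
  by (rule automorphismI) auto

lemma automorphism_comp:
  "\<phi> \<in> algebra_automorphisms scale \<Longrightarrow> \<psi> \<in> algebra_automorphisms scale \<Longrightarrow> \<phi> \<circ> \<psi> \<in> algebra_automorphisms scale"
  by (rule automorphismI) (auto simp: automorphismD intro: bij_comp)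

lemma automorphism_inv:
  assumes "\<phi> \<in> algebra_automorphisms scale"
  shows "inv_into UNIV \<phi> \<in> algebra_automorphisms scale"
proof -
  have inj: "inj \<phi>" and [simp]: "\<And>x. \<phi> (inv_into UNIV \<phi> x) = x"
    using automorphismD(1)[OF assms] by (auto simp: bij_def surj_f_inv_f)
  show ?thesis
    by (rule automorphismI; (rule injD[OF inj])?)
      (simp_all add: automorphismD(1)[OF assms] bij_imp_bij_inv automorphismD(2-4)[OF assms])
qed

text \<open>With a basis of the generating subspace for \<open>S\<close>, this is how identities
  between automorphisms are checked from here on.\<close>

lemma automorphism_eqI:
  assumes "\<phi> \<in> algebra_automorphisms scale" "\<psi> \<in> algebra_automorphisms scale"
    and gen: "generated_algebra scale (span S) = UNIV"
    and eq: "\<And>x. x \<in> S \<Longrightarrow> \<phi> x = \<psi> x"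
  shows "\<phi> = \<psi>"
proof
  fix x
  have "x \<in> generated_algebra scale (span S)" using gen by simp
  then show "\<phi> x = \<psi> x"
  proof induction
    case (incl x)
    then show ?case
      by (induction rule: span_induct_alt)
        (simp_all add: automorphismD[OF assms(1)] automorphismD[OF assms(2)] eq)
  qed (simp_all add: automorphismD[OF assms(1)] automorphismD[OF assms(2)])
qed

section \<open>Gradings by a commutative monoid and their diagonal automorphisms\<close>

text \<open>The degree monoid is arbitrary because an auxiliary grading by the integers is
  constructed later besides the given one by \<open>nat\<close>.\<close>

definition grading :: "('i::comm_monoid_add \<Rightarrow> 'a set) \<Rightarrow> bool" where
  "grading B \<longleftrightarrow> (\<forall>i. subspace (B i)) \<and> (\<forall>i j. \<forall>x\<in>B i. \<forall>y\<in>B j. x * y \<in> B (i + j)) \<and>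
     (\<forall>x. \<exists>!c. (\<forall>i. c i \<in> B i) \<and> finite {i. c i \<noteq> 0} \<and> x = (\<Sum>i | c i \<noteq> 0. c i))"

definition component :: "('i \<Rightarrow> 'a set) \<Rightarrow> 'a \<Rightarrow> 'i \<Rightarrow> 'a" where
  "component B x = (THE c. (\<forall>i. c i \<in> B i) \<and> finite {i. c i \<noteq> 0} \<and> x = (\<Sum>i | c i \<noteq> 0. c i))"

lemma component:
  assumes "grading B"
  shows "component B x i \<in> B i" "finite {i. component B x i \<noteq> 0}"
    "(\<Sum>i | component B x i \<noteq> 0. component B x i) = x"
proof -
  have "\<exists>!c. (\<forall>i. c i \<in> B i) \<and> finite {i. c i \<noteq> 0} \<and> x = (\<Sum>i | c i \<noteq> 0. c i)"
    using assms by (auto simp: grading_def)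
  from theI'[OF this] show "component B x i \<in> B i" "finite {i. component B x i \<noteq> 0}"
    "(\<Sum>i | component B x i \<noteq> 0. component B x i) = x"
    by (auto simp: component_def)
qed

lemma component_unique:
  assumes "grading B" "finite I" "\<And>i. c i \<in> B i" "\<And>i. i \<notin> I \<Longrightarrow> c i = 0" "x = (\<Sum>i\<in>I. c i)"
  shows "component B x = c"
  unfolding component_def
proof (rule the1_equality)
  show "\<exists>!c. (\<forall>i. c i \<in> B i) \<and> finite {i. c i \<noteq> 0} \<and> x = (\<Sum>i | c i \<noteq> 0. c i)"
    using assms(1) by (auto simp: grading_def)
  have "{i. c i \<noteq> 0} \<subseteq> I" using assms(4) by auto
  then show "(\<forall>i. c i \<in> B i) \<and> finite {i. c i \<noteq> 0} \<and> x = (\<Sum>i | c i \<noteq> 0. c i)"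
    using assms(2,3,5) by (auto intro: finite_subset intro!: sum.mono_neutral_right)
qed

lemma component_sum:
  assumes "grading B" "finite I" "{i. component B x i \<noteq> 0} \<subseteq> I"
  shows "(\<Sum>i\<in>I. component B x i) = x"
proof -
  have "(\<Sum>i\<in>I. component B x i) = (\<Sum>i | component B x i \<noteq> 0. component B x i)"
    using assms by (intro sum.mono_neutral_right) auto
  then show ?thesis using component(3)[OF assms(1)] by simp
qed

lemma component_add:
  assumes B: "grading B"
  shows "component B (x + y) = (\<lambda>i. component B x i + component B y i)"
proof (rule component_unique[OF B])
  let ?I = "{i. component B x i \<noteq> 0} \<union> {i. component B y i \<noteq> 0}"
  show fin: "finite ?I" using component(2)[OF B] by auto
  show "x + y = (\<Sum>i\<in>?I. component B x i + component B y i)"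
    using component_sum[OF B fin] by (simp add: sum.distrib)
qed (use B component(1)[OF B] in \<open>auto simp: grading_def intro: subspace_add\<close>)

lemma component_scale:
  assumes B: "grading B"
  shows "component B (scale a x) = (\<lambda>i. scale a (component B x i))"
proof (rule component_unique[OF B component(2)[OF B, of x]])
  show "scale a x = (\<Sum>i | component B x i \<noteq> 0. scale a (component B x i))"
    using component(3)[OF B, of x] by (simp add: scale_sum_right[symmetric])
qed (use B component(1)[OF B] in \<open>auto simp: grading_def intro: subspace_scale\<close>)

lemma component_homogeneous:
  assumes B: "grading B" "x \<in> B i"
  shows "component B x = (\<lambda>j. if j = i then x else 0)"
  by (rule component_unique[OF B(1), of "{i}"])
    (use B in \<open>auto simp: grading_def intro: subspace_0\<close>)

definition graded_scaling :: "('i \<Rightarrow> 'a set) \<Rightarrow> ('i \<Rightarrow> 'k) \<Rightarrow> 'a \<Rightarrow> 'a" where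
  "graded_scaling B \<chi> x = (\<Sum>i | component B x i \<noteq> 0. scale (\<chi> i) (component B x i))"

lemma graded_scaling_eq:
  assumes "grading B" "finite I" "{i. component B x i \<noteq> 0} \<subseteq> I"
  shows "graded_scaling B \<chi> x = (\<Sum>i\<in>I. scale (\<chi> i) (component B x i))"
  unfolding graded_scaling_def using assms by (intro sum.mono_neutral_left) auto

lemma graded_scaling_homogeneous:
  assumes "grading B" "x \<in> B i"
  shows "graded_scaling B \<chi> x = scale (\<chi> i) x"
  by (subst graded_scaling_eq[OF assms(1), of "{i}"]) (auto simp: component_homogeneous[OF assms])

lemma graded_scaling_add:
  assumes B: "grading B"
  shows "graded_scaling B \<chi> (x + y) = graded_scaling B \<chi> x + graded_scaling B \<chi> y"
proof -
  let ?I = "{i. component B x i \<noteq> 0} \<union> {i. component B y i \<noteq> 0}"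
  have "finite ?I" using component(2)[OF B] by auto
  then show ?thesis
    by (subst (1 2 3) graded_scaling_eq[OF B, of ?I])
      (auto simp: component_add[OF B] scale_right_distrib sum.distrib)
qed

lemma graded_scaling_scale:
  assumes B: "grading B"
  shows "graded_scaling B \<chi> (scale a x) = scale a (graded_scaling B \<chi> x)"
  by (subst (1 2) graded_scaling_eq[OF B component(2)[OF B, of x]])
    (auto simp: component_scale[OF B] scale_sum_right mult.commute)

lemma graded_scaling_sum:
  assumes B: "grading B"
  shows "graded_scaling B \<chi> (sum f I) = (\<Sum>i\<in>I. graded_scaling B \<chi> (f i))"
proof -
  have "graded_scaling B \<chi> 0 = 0"
    using graded_scaling_scale[OF B, of \<chi> 0 0] by simp
  then show ?thesis
    by (induction I rule: infinite_finite_induct) (simp_all add: graded_scaling_add[OF B])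
qed

text \<open>Multiplicativity of \<open>\<chi>\<close> matches the addition of degrees in products,
  and the scaling by the pointwise inverse of \<open>\<chi>\<close> is a two-sided inverse.\<close>

lemma graded_scaling_automorphism:
  assumes B: "grading B" and \<chi>: "\<And>i j. \<chi> (i + j) = \<chi> i * \<chi> j" "\<And>i. \<chi> i \<noteq> 0"
  shows "graded_scaling B \<chi> \<in> algebra_automorphisms scale"
proof (rule automorphismI)
  have inverse: "graded_scaling B \<chi>1 (graded_scaling B \<chi>2 x) = x" if "\<And>i. \<chi>1 i * \<chi>2 i = 1" for \<chi>1 \<chi>2 x
  proof -
    have "graded_scaling B \<chi>1 (graded_scaling B \<chi>2 x)
        = (\<Sum>i | component B x i \<noteq> 0. graded_scaling B \<chi>1 (scale (\<chi>2 i) (component B x i)))"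
      by (simp add: graded_scaling_def[of B \<chi>2 x] graded_scaling_sum[OF B])
    also have "\<dots> = (\<Sum>i | component B x i \<noteq> 0. component B x i)"
      using that by (simp add: graded_scaling_scale[OF B]
          graded_scaling_homogeneous[OF B component(1)[OF B]] mult.commute)
    finally show ?thesis using component(3)[OF B] by simp
  qed
  show "bij (graded_scaling B \<chi>)"
    by (rule bij_betw_byWitness[where f' = "graded_scaling B (\<lambda>i. inverse (\<chi> i))"])
      (use \<chi>(2) in \<open>auto simp: inverse\<close>)
next
  fix x y
  let ?X = "{i. component B x i \<noteq> 0}" and ?Y = "{i. component B y i \<noteq> 0}"
  have "x * y = (\<Sum>i\<in>?X. \<Sum>j\<in>?Y. component B x i * component B y j)"
    using component(3)[OF B, of x] component(3)[OF B, of y] by (metis sum_product)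
  then have "graded_scaling B \<chi> (x * y)
      = (\<Sum>i\<in>?X. \<Sum>j\<in>?Y. graded_scaling B \<chi> (component B x i * component B y j))"
    by (simp add: graded_scaling_sum[OF B])
  also have "\<dots> = (\<Sum>i\<in>?X. \<Sum>j\<in>?Y. scale (\<chi> i) (component B x i) * scale (\<chi> j) (component B y j))"
  proof (intro sum.cong refl)
    fix i j
    have "component B x i * component B y j \<in> B (i + j)"
      using B component(1)[OF B] by (auto simp: grading_def)
    then show "graded_scaling B \<chi> (component B x i * component B y j)
        = scale (\<chi> i) (component B x i) * scale (\<chi> j) (component B y j)"
      by (simp add: graded_scaling_homogeneous[OF B] \<chi>(1) scale_mult_left scale_mult_right mult.commute)
  qed
  also have "\<dots> = graded_scaling B \<chi> x * graded_scaling B \<chi> y"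
    by (simp add: graded_scaling_def sum_product)
  finally show "graded_scaling B \<chi> (x * y) = graded_scaling B \<chi> x * graded_scaling B \<chi> y" .
qed (simp_all add: graded_scaling_add[OF B] graded_scaling_scale[OF B])

text \<open>Eigenvalues multiply, so the sums of eigenvectors form a subalgebra, which contains a
  generating set; independence of characters makes the sum direct. The resulting grading may be
  rescaled by parameters that do not occur in the family \<open>\<rho>\<close>, and this is its
  purpose.\<close>

lemma eigenspace_grading:
  assumes \<rho>: "\<And>q. q \<in> M \<Longrightarrow> \<rho> q \<in> algebra_automorphisms scale"
    and u: "u \<in> M" "\<And>q q'. q \<in> M \<Longrightarrow> q' \<in> M \<Longrightarrow> f q q' \<in> M"
    and \<chi>0: "\<And>q. q \<in> M \<Longrightarrow> \<chi> (0::'i::comm_monoid_add) q = 1"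
    and \<chi>_add: "\<And>q i j. q \<in> M \<Longrightarrow> \<chi> (i + j) q = \<chi> i q * \<chi> j q"
    and \<chi>_mult: "\<And>q q' i. q \<in> M \<Longrightarrow> q' \<in> M \<Longrightarrow> \<chi> i (f q q') = \<chi> i q * \<chi> i q'"
    and \<chi>_nz: "\<And>q i. q \<in> M \<Longrightarrow> \<chi> i q \<noteq> 0"
    and \<chi>_distinct: "\<And>i j. i \<noteq> j \<Longrightarrow> \<exists>q\<in>M. \<chi> i q \<noteq> \<chi> j q"
    and gen: "generated_algebra scale (span S) = UNIV"
    and S: "\<And>x. x \<in> S \<Longrightarrow> \<exists>i. \<forall>q\<in>M. \<rho> q x = scale (\<chi> i q) x"
  shows "grading (\<lambda>i. {x. \<forall>q\<in>M. \<rho> q x = scale (\<chi> i q) x})" (is "grading ?B")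
proof -
  note D = automorphismD[OF \<rho>]
  have sub: "subspace (?B i)" for i
    by (auto simp: subspace_def D scale_right_distrib mult.commute)
  have mult: "x * y \<in> ?B (i + j)" if "x \<in> ?B i" "y \<in> ?B j" for x y i j
    using that by (auto simp: D \<chi>_add scale_mult_left scale_mult_right mult.commute)
  \<comment> \<open>Existence of decompositions: \<open>U\<close> is shown to be a subalgebra
    containing the span of \<open>S\<close>.\<close>
  define U where "U = {x. \<exists>I c. finite I \<and> (\<forall>i. c i \<in> ?B i) \<and> (\<forall>i. i \<notin> I \<longrightarrow> c i = 0) \<and> x = (\<Sum>i\<in>I. c i)}"
  have U_hom: "x \<in> U" if "x \<in> ?B i" for x i
    unfolding U_def
    by (rule CollectI, rule exI[of _ "{i}"], rule exI[of _ "\<lambda>j. if j = i then x else 0"])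
      (use that subspace_0[OF sub] in auto)
  have U_add: "x + y \<in> U" if "x \<in> U" "y \<in> U" for x y
  proof -
    obtain I c where I: "finite I" "\<And>i. c i \<in> ?B i" "\<And>i. i \<notin> I \<Longrightarrow> c i = 0" "x = (\<Sum>i\<in>I. c i)"
      using \<open>x \<in> U\<close> unfolding U_def by blast
    obtain J b where J: "finite J" "\<And>i. b i \<in> ?B i" "\<And>i. i \<notin> J \<Longrightarrow> b i = 0" "y = (\<Sum>i\<in>J. b i)"
      using \<open>y \<in> U\<close> unfolding U_def by blast
    have "x = (\<Sum>i\<in>I \<union> J. c i)" "y = (\<Sum>i\<in>I \<union> J. b i)"
      unfolding I(4) J(4) using I J by (auto intro!: sum.mono_neutral_left)
    then show ?thesis unfolding U_def
      using I(1-3) J(1-3) subspace_add[OF sub]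
      by (intro CollectI exI[of _ "I \<union> J"] exI[of _ "\<lambda>i. c i + b i"]) (auto simp: sum.distrib)
  qed
  have U_0: "0 \<in> U" using U_hom subspace_0[OF sub] by blast
  have U_sum: "sum g I \<in> U" if "\<And>i. i \<in> I \<Longrightarrow> g i \<in> U" for g and I :: "'i set"
    using that by (induction I rule: infinite_finite_induct) (auto intro: U_add U_0)
  have U_scale: "scale a x \<in> U" if "x \<in> U" for a x
  proof -
    obtain I c where I: "finite I" "\<And>i. c i \<in> ?B i" "x = (\<Sum>i\<in>I. c i)"
      using \<open>x \<in> U\<close> unfolding U_def by blast
    show ?thesis unfolding I(3) scale_sum_right
      by (rule U_sum, rule U_hom, rule subspace_scale[OF sub], rule I(2))
  qed
  have U_mult: "x * y \<in> U" if "x \<in> U" "y \<in> U" for x y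
  proof -
    obtain I c where I: "\<And>i. c i \<in> ?B i" "x = (\<Sum>i\<in>I. c i)"
      using \<open>x \<in> U\<close> unfolding U_def by blast
    obtain J b where J: "\<And>i. b i \<in> ?B i" "y = (\<Sum>i\<in>J. b i)"
      using \<open>y \<in> U\<close> unfolding U_def by blast
    show ?thesis unfolding I(2) J(2) sum_product
      by (rule U_sum, rule U_sum, rule U_hom, rule mult, rule I(1), rule J(1))
  qed
  have U_span: "x \<in> U" if "x \<in> span S" for x
    using that
  proof (induction rule: span_induct_alt)
    case (step c x y)
    then show ?case using S U_hom U_scale U_add by blast
  qed (rule U_0)
  have U: "x \<in> U" for x
  proof -
    have "x \<in> generated_algebra scale (span S)" using gen by simp
    then show ?thesis
    proof induction
      case one
      have "1 \<in> ?B 0" by (simp add: D \<chi>0)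
      then show ?case by (rule U_hom)
    qed (auto intro: U_span U_add U_mult U_scale)
  qed
  \<comment> \<open>Uniqueness of decompositions: \<open>\<rho> q\<close> multiplies each term of a
    vanishing sum by its character.\<close>
  have zero: "g i = 0" if g: "finite I" "\<And>i. g i \<in> ?B i" "(\<Sum>i\<in>I. g i) = 0" "i \<in> I" for I g i
  proof (rule characters_independent[where \<chi> = \<chi> and M = M and f = f and v = g, OF g(1) u(1) \<chi>_nz])
    fix q assume q: "q \<in> M"
    have "(\<Sum>i\<in>I. scale (\<chi> i q) (g i)) = \<rho> q (\<Sum>i\<in>I. g i)"
      unfolding D(8)[OF q] using g(2) q by (intro sum.cong) auto
    then show "(\<Sum>i\<in>I. scale (\<chi> i q) (g i)) = 0"
      using g(3) D(6)[OF q] by simp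
  qed (use u \<chi>_mult \<chi>_distinct g in auto)
  have "\<exists>!c. (\<forall>i. c i \<in> ?B i) \<and> finite {i. c i \<noteq> 0} \<and> x = (\<Sum>i | c i \<noteq> 0. c i)" for x
  proof (rule ex_ex1I)
    obtain I c where I: "finite I" "\<And>i. c i \<in> ?B i" "\<And>i. i \<notin> I \<Longrightarrow> c i = 0" "x = (\<Sum>i\<in>I. c i)"
      using U[of x] unfolding U_def by blast
    have "{i. c i \<noteq> 0} \<subseteq> I" using I(3) by auto
    then have "finite {i. c i \<noteq> 0}" "x = (\<Sum>i | c i \<noteq> 0. c i)"
      unfolding I(4) using I(1) by (auto intro: finite_subset intro!: sum.mono_neutral_right)
    then show "\<exists>c. (\<forall>i. c i \<in> ?B i) \<and> finite {i. c i \<noteq> 0} \<and> x = (\<Sum>i | c i \<noteq> 0. c i)"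
      using I(2) by blast
  next
    fix c b
    assume c: "(\<forall>i. c i \<in> ?B i) \<and> finite {i. c i \<noteq> 0} \<and> x = (\<Sum>i | c i \<noteq> 0. c i)"
      and b: "(\<forall>i. b i \<in> ?B i) \<and> finite {i. b i \<noteq> 0} \<and> x = (\<Sum>i | b i \<noteq> 0. b i)"
    let ?I = "{i. c i \<noteq> 0} \<union> {i. b i \<noteq> 0}"
    have fin: "finite ?I" using b c by auto
    have "x = (\<Sum>i\<in>?I. c i)" using c fin by (auto intro!: sum.mono_neutral_left)
    moreover have "x = (\<Sum>i\<in>?I. b i)" using b fin by (auto intro!: sum.mono_neutral_left)
    ultimately have "(\<Sum>i\<in>?I. c i - b i) = 0" by (simp add: sum_subtractf)
    then have "c i - b i = 0" if "i \<in> ?I" for i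
      using zero[of ?I "\<lambda>i. c i - b i" i, OF fin] \<open>(\<Sum>i\<in>?I. c i - b i) = 0\<close> that b c subspace_diff[OF sub]
      by blast
    then have "c i = b i" for i by (cases "i \<in> ?I") auto
    then show "c = b" by (simp add: fun_eq_iff)
  qed
  then show ?thesis unfolding grading_def using sub mult by blast
qed

section \<open>Groups of automorphisms preserving a family of subspaces\<close>

text \<open>A common form of both groups: \<open>C = A\<close> gives the graded automorphisms,
  \<open>C = filtration A\<close> the filtered ones.\<close>

definition stabilizer :: "('i \<Rightarrow> 'a set) \<Rightarrow> ('a \<Rightarrow> 'a) set" where
  "stabilizer C = {\<phi> \<in> algebra_automorphisms scale. \<forall>n. \<phi> ` C n = C n}"

lemma stabilizer_id: "id \<in> stabilizer C"
  by (simp add: stabilizer_def automorphism_id)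

lemma stabilizer_comp: "\<phi> \<in> stabilizer C \<Longrightarrow> \<psi> \<in> stabilizer C \<Longrightarrow> \<phi> \<circ> \<psi> \<in> stabilizer C"
  by (auto simp only: stabilizer_def mem_Collect_eq automorphism_comp image_comp[symmetric])

lemma stabilizer_inv: "\<phi> \<in> stabilizer C \<Longrightarrow> inv_into UNIV \<phi> \<in> stabilizer C"
  unfolding stabilizer_def using automorphismD(1) automorphism_inv
  by (auto simp: bij_def) (metis image_inv_f_f inv_f_f imageI)+

lemma stabilizer_automorphism: "\<phi> \<in> stabilizer C \<Longrightarrow> \<phi> \<in> algebra_automorphisms scale"
  by (simp add: stabilizer_def)

lemma restriction_group_simps:
  "carrier (restriction_group scale V X) = X"
  "monoid.mult (restriction_group scale V X) = (\<circ>)"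
  "one (restriction_group scale V X) = id"
  by (simp_all add: restriction_group_def)

lemma stabilizer_comp_inv:
  assumes "\<phi> \<in> stabilizer C"
  shows "inv_into UNIV \<phi> \<circ> \<phi> = id" "\<phi> \<circ> inv_into UNIV \<phi> = id"
  using automorphismD(1)[OF stabilizer_automorphism[OF assms]]
  by (auto simp: bij_def fun_eq_iff surj_f_inv_f)

lemma group_stabilizer: "group (restriction_group scale V (stabilizer C))"
  by (rule groupI)
    (auto simp: restriction_group_simps stabilizer_id stabilizer_comp comp_assoc
      intro: bexI[OF _ stabilizer_inv] stabilizer_comp_inv)

lemma inv_stabilizer:
  assumes "\<phi> \<in> stabilizer C"
  shows "inv\<^bsub>restriction_group scale V (stabilizer C)\<^esub> \<phi> = inv_into UNIV \<phi>"
  using assms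
  by (intro group.inv_equality[OF group_stabilizer])
    (auto simp: restriction_group_simps stabilizer_inv stabilizer_comp_inv)

text \<open>The right-hand side involves \<open>C\<close> only through the inclusion of
  \<open>T\<close>, which lets subgroups pass between the graded and the filtered group.\<close>

lemma subgroup_stabilizer_iff:
  "subgroup T (restriction_group scale V (stabilizer C)) \<longleftrightarrow>
     T \<subseteq> stabilizer C \<and> id \<in> T \<and> (\<forall>\<phi>\<in>T. \<forall>\<psi>\<in>T. \<phi> \<circ> \<psi> \<in> T) \<and> (\<forall>\<phi>\<in>T. inv_into UNIV \<phi> \<in> T)"
  by (auto simp: subgroup_def restriction_group_simps inv_stabilizer subset_iff)

end

context graded_algebra
begin

lemma grading_component: "grading A"
  using subspace_component mult_component direct_sum by (auto simp: grading_def)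

definition degree_scaling :: "'k \<Rightarrow> 'a \<Rightarrow> 'a" where
  "degree_scaling q = graded_scaling A (\<lambda>n. q ^ n)"

lemma degree_scaling_automorphism: "q \<noteq> 0 \<Longrightarrow> degree_scaling q \<in> algebra_automorphisms scale"
  unfolding degree_scaling_def
  by (rule graded_scaling_automorphism[OF grading_component]) (auto simp: power_add)

lemma degree_scaling_homogeneous: "x \<in> A n \<Longrightarrow> degree_scaling q x = scale (q ^ n) x"
  unfolding degree_scaling_def by (rule graded_scaling_homogeneous[OF grading_component])

text \<open>For \<open>x\<close> in \<open>A n\<close>, scaling multiplies \<open>\<phi> x\<close>
  by \<open>q^n\<close>, but its component of degree \<open>i\<close> by \<open>q^i\<close>.
  Independence of these powers as characters of \<open>q\<close> leaves only the component of degree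
  \<open>n\<close>.\<close>

lemma commutes_degree_scaling:
  assumes inf: "infinite (UNIV :: 'k set)" and \<phi>: "\<phi> \<in> algebra_automorphisms scale"
    and comm: "\<And>q. q \<noteq> 0 \<Longrightarrow> \<phi> \<circ> degree_scaling q = degree_scaling q \<circ> \<phi>"
  shows "\<phi> \<in> stabilizer A"
proof -
  have *: "\<phi> x \<in> A n" if \<phi>: "\<phi> \<in> algebra_automorphisms scale" and x: "x \<in> A n"
    and comm: "\<And>q. q \<noteq> 0 \<Longrightarrow> \<phi> \<circ> degree_scaling q = degree_scaling q \<circ> \<phi>" for \<phi> x n
  proof -
    let ?c = "component A (\<phi> x)"
    let ?I = "insert n {i. ?c i \<noteq> 0}"
    have fin: "finite ?I" using component(2)[OF grading_component] by auto
    \<comment> \<open>The subtracted term \<open>q^n \<phi> x\<close> is absorbed into the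
      coefficient at \<open>n\<close>; hence the update of \<open>?c\<close> and the insertion of
      \<open>n\<close> into \<open>?I\<close>.\<close>
    have "(?c(n := ?c n - \<phi> x)) n = 0"
    proof (rule characters_independent[where M = "UNIV - {0}" and f = "(*)" and u = 1
          and F = ?I and \<chi> = "\<lambda>i q. q ^ i" and v = "?c(n := ?c n - \<phi> x)"])
      fix q :: 'k assume q: "q \<in> UNIV - {0}"
      have "degree_scaling q (\<phi> x) = (\<Sum>i\<in>?I. scale (q ^ i) (?c i))"
        unfolding degree_scaling_def by (rule graded_scaling_eq[OF grading_component fin]) auto
      moreover have "degree_scaling q (\<phi> x) = \<phi> (degree_scaling q x)"
        using comm[of q] q by (auto simp: fun_eq_iff)
      moreover have "\<dots> = scale (q ^ n) (\<phi> x)"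
        by (simp add: degree_scaling_homogeneous[OF x] automorphismD[OF \<phi>])
      moreover have "(\<Sum>i\<in>?I. scale (q ^ i) ((?c(n := ?c n - \<phi> x)) i))
          = (\<Sum>i\<in>?I. scale (q ^ i) (?c i)) - scale (q ^ n) (\<phi> x)"
        using fin by (simp add: sum.insert_remove scale_right_diff_distrib)
      ultimately show "(\<Sum>i\<in>?I. scale (q ^ i) ((?c(n := ?c n - \<phi> x)) i)) = 0"
        by simp
    next
      fix i j :: nat assume "i \<noteq> j"
      then show "\<exists>s\<in>UNIV - {0}. s ^ i \<noteq> (s :: 'k) ^ j"
        using powi_separates[OF inf, of "int i" "int j"] by auto
    qed (use fin in \<open>auto simp: power_mult_distrib\<close>)
    then show ?thesis
      using component(1)[OF grading_component, of "\<phi> x" n] by simp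
  qed
  have bij: "bij \<phi>" by (rule automorphismD(1)[OF \<phi>])
  \<comment> \<open>Applying the inclusion to the inverse as well turns it into the equality of
    \<open>A n\<close> with its image.\<close>
  have comm': "inv_into UNIV \<phi> \<circ> degree_scaling q = degree_scaling q \<circ> inv_into UNIV \<phi>" if "q \<noteq> 0" for q
  proof
    fix x
    have "\<phi> (degree_scaling q (inv_into UNIV \<phi> x)) = degree_scaling q x"
      using comm[OF that] bij by (simp add: fun_eq_iff bij_def surj_f_inv_f)
    then show "(inv_into UNIV \<phi> \<circ> degree_scaling q) x = (degree_scaling q \<circ> inv_into UNIV \<phi>) x"
      using bij by (metis bij_inv_eq_iff comp_apply)
  qed
  have "\<phi> ` A n = A n" for n
  proof
    show "\<phi> ` A n \<subseteq> A n" using *[OF \<phi> _ comm] by auto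
    show "A n \<subseteq> \<phi> ` A n"
    proof
      fix x assume "x \<in> A n"
      then have "inv_into UNIV \<phi> x \<in> A n" using *[OF automorphism_inv[OF \<phi>] _ comm'] by auto
      then show "x \<in> \<phi> ` A n" using bij by (metis bij_inv_eq_iff imageI)
    qed
  qed
  with \<phi> show ?thesis by (simp add: stabilizer_def)
qed

lemma stabilizer_filtration:
  assumes "\<phi> \<in> stabilizer A"
  shows "\<phi> \<in> stabilizer (filtration A)"
proof -
  have *: "\<phi> x \<in> filtration A n" if \<phi>: "\<phi> \<in> stabilizer A" and x: "x \<in> filtration A n" for \<phi> x n
  proof -
    obtain c where c: "x = (\<Sum>k\<le>n. c k)" "\<forall>k\<le>n. c k \<in> A k"
      using x by (auto simp: filtration_def)
    have "\<phi> x = (\<Sum>k\<le>n. \<phi> (c k))"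
      unfolding c(1) by (rule automorphismD(8)[OF stabilizer_automorphism[OF \<phi>]])
    moreover have "\<forall>k\<le>n. \<phi> (c k) \<in> A k"
      using \<phi> c(2) by (auto simp: stabilizer_def)
    ultimately show ?thesis by (auto simp: filtration_def intro!: exI[of _ "\<lambda>k. \<phi> (c k)"])
  qed
  have "\<phi> ` filtration A n = filtration A n" for n
  proof
    show "\<phi> ` filtration A n \<subseteq> filtration A n" using *[OF assms] by auto
    show "filtration A n \<subseteq> \<phi> ` filtration A n"
    proof
      fix x assume "x \<in> filtration A n"
      then have "inv_into UNIV \<phi> x \<in> filtration A n" using *[OF stabilizer_inv[OF assms]] by auto
      then show "x \<in> \<phi> ` filtration A n"
        using stabilizer_comp_inv(2)[OF assms] by (metis comp_apply id_apply imageI)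
    qed
  qed
  with assms show ?thesis by (simp add: stabilizer_def)
qed

lemma Aut_fl_eq: "Aut_fl scale A d = restriction_group scale (filtration A d) (stabilizer (filtration A))"
  and Aut_gr_eq: "Aut_gr scale A d = restriction_group scale (filtration A d) (stabilizer A)"
  by (simp_all add: Aut_fl_def Aut_gr_def stabilizer_def)

end

section \<open>Regular functions on groups of automorphisms\<close>

context unital_algebra
begin

lemma ordered_basisD:
  assumes "ordered_basis scale V bs"
  shows "distinct bs" "independent (set bs)" "span (set bs) = V"
  using assms by (auto simp: ordered_basis_def)

lemma ordered_basis_expand:
  assumes "ordered_basis scale V bs" "x \<in> V"
  shows "x = (\<Sum>k<length bs. scale (representation (set bs) x (bs ! k)) (bs ! k))"
proof -
  note b = ordered_basisD[OF assms(1)]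
  have "(\<Sum>v\<in>set bs. scale (representation (set bs) x v) v) = x"
    by (rule sum_representation_eq) (use b assms(2) in auto)
  then show ?thesis
    by (simp add: sum.reindex_bij_betw[OF bij_betw_nth[OF b(1) refl refl],
        of "\<lambda>v. scale (representation (set bs) x v) v"])
qed

lemma ordered_basis_nth: "ordered_basis scale V bs \<Longrightarrow> j < length bs \<Longrightarrow> bs ! j \<in> V"
  using ordered_basisD(3) span_base nth_mem by blast

lemma representation_sum_ordered_basis:
  assumes "ordered_basis scale V bs" "\<And>i. i \<in> I \<Longrightarrow> f i \<in> V"
  shows "representation (set bs) (\<Sum>i\<in>I. scale (c i) (f i)) b = (\<Sum>i\<in>I. c i * representation (set bs) (f i) b)"
  using assms ordered_basisD[OF assms(1)]
  by (subst representation_sum) (auto simp: representation_scale span_scale intro!: sum.cong)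

lemma matrix_of_dim [simp]: "matrix_of scale bs \<phi> \<in> carrier_mat (length bs) (length bs)"
  "dim_row (matrix_of scale bs \<phi>) = length bs" "dim_col (matrix_of scale bs \<phi>) = length bs"
  by (simp_all add: matrix_of_def)

lemma matrix_of_nth:
  "i < length bs \<Longrightarrow> j < length bs \<Longrightarrow>
    matrix_of scale bs \<phi> $$ (i, j) = representation (set bs) (\<phi> (bs ! j)) (bs ! i)"
  by (simp add: matrix_of_def)

lemma matrix_of_restrict:
  assumes "ordered_basis scale V bs"
  shows "matrix_of scale bs (restrict \<phi> V) = matrix_of scale bs \<phi>"
  by (rule eq_matI) (auto simp: matrix_of_def ordered_basis_nth[OF assms])

lemma automorphism_basis_image:
  assumes bs: "ordered_basis scale V bs" and \<phi>: "\<phi> \<in> algebra_automorphisms scale" "x \<in> V"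
  shows "\<phi> x = (\<Sum>k<length bs. scale (representation (set bs) x (bs ! k)) (\<phi> (bs ! k)))"
proof -
  have "\<phi> x = \<phi> (\<Sum>k<length bs. scale (representation (set bs) x (bs ! k)) (bs ! k))"
    using ordered_basis_expand[OF bs \<phi>(2)] by simp
  then show ?thesis by (simp add: automorphismD[OF \<phi>(1)])
qed

lemma matrix_of_comp:
  assumes bs: "ordered_basis scale V bs" and \<phi>: "\<phi> \<in> algebra_automorphisms scale"
    and inv: "\<And>x. x \<in> V \<Longrightarrow> \<phi> x \<in> V" "\<And>x. x \<in> V \<Longrightarrow> \<psi> x \<in> V"
  shows "matrix_of scale bs (\<phi> \<circ> \<psi>) = matrix_of scale bs \<phi> * matrix_of scale bs \<psi>"
proof (rule eq_matI)
  fix i j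
  assume "i < dim_row (matrix_of scale bs \<phi> * matrix_of scale bs \<psi>)"
    "j < dim_col (matrix_of scale bs \<phi> * matrix_of scale bs \<psi>)"
  then have ij: "i < length bs" "j < length bs" by simp_all
  have "representation (set bs) (\<phi> (\<psi> (bs ! j))) (bs ! i)
      = (\<Sum>k<length bs. representation (set bs) (\<psi> (bs ! j)) (bs ! k) * representation (set bs) (\<phi> (bs ! k)) (bs ! i))"
    by (subst automorphism_basis_image[OF bs \<phi>], rule inv(2), rule ordered_basis_nth[OF bs ij(2)],
        rule representation_sum_ordered_basis[OF bs], rule inv(1), rule ordered_basis_nth[OF bs]) auto
  then show "matrix_of scale bs (\<phi> \<circ> \<psi>) $$ (i, j) = (matrix_of scale bs \<phi> * matrix_of scale bs \<psi>) $$ (i, j)"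
    using ij by (simp add: matrix_of_nth scalar_prod_def lessThan_atLeast0 mult.commute)
qed simp_all

lemma matrix_of_id:
  assumes bs: "ordered_basis scale V bs"
  shows "matrix_of scale bs id = 1\<^sub>m (length bs)"
  using ordered_basisD[OF bs]
  by (intro eq_matI) (auto simp: matrix_of_nth representation_basis nth_eq_iff_index_eq)

text \<open>Inverse automorphisms have inverse matrices. The inverse determinant thus becomes a
  polynomial in matrix entries of the inverse, and pulling it back along a diagonal family requires
  no division by a Laurent polynomial.\<close>

lemma inverse_det_matrix_of:
  assumes bs: "ordered_basis scale V bs" and \<phi>: "\<phi> \<in> algebra_automorphisms scale" "\<phi> ` V = V"
  shows "inverse (det (matrix_of scale bs \<phi>)) = det (matrix_of scale bs (inv_into UNIV \<phi>))"
proof -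
  have bij: "bij \<phi>" by (rule automorphismD(1)[OF \<phi>(1)])
  have "matrix_of scale bs \<phi> * matrix_of scale bs (inv_into UNIV \<phi>)
      = matrix_of scale bs (\<phi> \<circ> inv_into UNIV \<phi>)"
  proof (rule matrix_of_comp[OF bs \<phi>(1), symmetric])
    fix x assume "x \<in> V"
    then obtain y where "y \<in> V" "x = \<phi> y" using \<phi>(2) by auto
    then show "inv_into UNIV \<phi> x \<in> V" using bij by (simp add: bij_def)
  qed (use \<phi>(2) in auto)
  also have "\<phi> \<circ> inv_into UNIV \<phi> = id" using bij by (auto simp: fun_eq_iff bij_def surj_f_inv_f)
  finally have "det (matrix_of scale bs \<phi>) * det (matrix_of scale bs (inv_into UNIV \<phi>)) = 1"
    by (metis det_mult matrix_of_dim(1) matrix_of_id[OF bs] det_one)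
  then show ?thesis
    by (metis inverse_unique)
qed

section \<open>Closure properties of the ring of regular functions\<close>

definition regular :: "'a set \<Rightarrow> ('a \<Rightarrow> 'a) set \<Rightarrow> (('a \<Rightarrow> 'a) \<Rightarrow> 'k) set" where
  "regular V X = coord (restriction_group scale V X)"

definition GL_generators :: "'a set \<Rightarrow> (('a \<Rightarrow> 'a) \<Rightarrow> 'k) set" where
  "GL_generators V =
     {\<lambda>\<phi>. matrix_of scale bs \<phi> $$ (i, j) | bs i j.
        ordered_basis scale V bs \<and> i < length bs \<and> j < length bs} \<union>
     {\<lambda>\<phi>. inverse (det (matrix_of scale bs \<phi>)) | bs. ordered_basis scale V bs}"

text \<open>Functions in the coordinate ring of \<open>GL\<close> are controlled only on its
  carrier, so restrictions of elements of \<open>X\<close> must first be seen to lie there. Then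
  \<open>g\<close> can be taken in the generated algebra itself and treated by induction.\<close>

lemma regular_iff:
  assumes V: "subspace V" and X: "X \<subseteq> algebra_automorphisms scale" "\<And>\<phi>. \<phi> \<in> X \<Longrightarrow> \<phi> ` V = V"
  shows "f \<in> regular V X \<longleftrightarrow> (\<exists>g \<in> generated_algebra (\<lambda>c g x. c * g x) (GL_generators V).
     \<forall>\<phi>\<in>X. f \<phi> = g (restrict \<phi> V))"
proof -
  have GL: "restrict \<phi> V \<in> carrier (GL scale V)" if "\<phi> \<in> X" for \<phi>
  proof -
    note D = automorphismD[OF subsetD[OF X(1) that]]
    have "inj_on \<phi> V" using D(1) by (auto simp: bij_def intro: inj_on_subset)
    then have "bij_betw (restrict \<phi> V) V V"
      using X(2)[OF that] by (simp add: bij_betw_def inj_on_restrict_eq)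
    then show ?thesis
      by (auto simp: GL_def Let_def D subspace_add[OF V] subspace_scale[OF V])
  qed
  have "coord (GL scale V) = function_algebra (carrier (GL scale V)) (GL_generators V)"
    by (simp add: GL_def Let_def GL_generators_def)
  then show ?thesis
    unfolding regular_def restriction_group_def function_algebra_def using GL by fastforce
qed

context
  fixes V X
  assumes V: "subspace V" and X: "X \<subseteq> algebra_automorphisms scale" "\<And>\<phi>. \<phi> \<in> X \<Longrightarrow> \<phi> ` V = V"
begin

lemma regular_iff': "f \<in> regular V X \<longleftrightarrow> (\<exists>g \<in> generated_algebra (\<lambda>c g x. c * g x) (GL_generators V).
     \<forall>\<phi>\<in>X. f \<phi> = g (restrict \<phi> V))"
  by (rule regular_iff) (use V X in auto)

lemma regular_const: "(\<lambda>\<phi>. c) \<in> regular V X"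
proof -
  have "(\<lambda>x. c * (1 :: ('a \<Rightarrow> 'a) \<Rightarrow> 'k) x) \<in> generated_algebra (\<lambda>c g x. c * g x) (GL_generators V)"
    by (rule generated_algebra.scale[OF generated_algebra.one])
  then show ?thesis by (auto simp: regular_iff' intro: rev_bexI)
qed

lemma regular_add:
  assumes "f \<in> regular V X" "g \<in> regular V X"
  shows "(\<lambda>\<phi>. f \<phi> + g \<phi>) \<in> regular V X"
proof -
  obtain f' g' where "f' \<in> generated_algebra (\<lambda>c g x. c * g x) (GL_generators V)" "\<forall>\<phi>\<in>X. f \<phi> = f' (restrict \<phi> V)"
    "g' \<in> generated_algebra (\<lambda>c g x. c * g x) (GL_generators V)" "\<forall>\<phi>\<in>X. g \<phi> = g' (restrict \<phi> V)"
    using assms by (auto simp: regular_iff')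
  then show ?thesis
    unfolding regular_iff' by (intro bexI[of _ "f' + g'"]) (auto intro: generated_algebra.add)
qed

lemma regular_mult:
  assumes "f \<in> regular V X" "g \<in> regular V X"
  shows "(\<lambda>\<phi>. f \<phi> * g \<phi>) \<in> regular V X"
proof -
  obtain f' g' where "f' \<in> generated_algebra (\<lambda>c g x. c * g x) (GL_generators V)" "\<forall>\<phi>\<in>X. f \<phi> = f' (restrict \<phi> V)"
    "g' \<in> generated_algebra (\<lambda>c g x. c * g x) (GL_generators V)" "\<forall>\<phi>\<in>X. g \<phi> = g' (restrict \<phi> V)"
    using assms by (auto simp: regular_iff')
  then show ?thesis
    unfolding regular_iff' by (intro bexI[of _ "f' * g'"]) (auto intro: generated_algebra.mult)
qed

lemma regular_diff:
  assumes "f \<in> regular V X" "g \<in> regular V X"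
  shows "(\<lambda>\<phi>. f \<phi> - g \<phi>) \<in> regular V X"
  using regular_add[OF assms(1) regular_mult[OF regular_const[of "-1"] assms(2)]] by simp

lemma regular_sum: "(\<And>i. i \<in> I \<Longrightarrow> f i \<in> regular V X) \<Longrightarrow> (\<lambda>\<phi>. \<Sum>i\<in>I. f i \<phi>) \<in> regular V X"
  by (induction I rule: infinite_finite_induct) (auto intro: regular_const regular_add)

lemma regular_prod: "(\<And>i. i \<in> I \<Longrightarrow> f i \<in> regular V X) \<Longrightarrow> (\<lambda>\<phi>. \<Prod>i\<in>I. f i \<phi>) \<in> regular V X"
  by (induction I rule: infinite_finite_induct) (auto intro: regular_const regular_mult)

lemma regular_power: "f \<in> regular V X \<Longrightarrow> (\<lambda>\<phi>. f \<phi> ^ n) \<in> regular V X"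
  by (induction n) (auto intro: regular_const regular_mult)

lemma regular_entry:
  assumes "ordered_basis scale V bs" "i < length bs" "j < length bs"
  shows "(\<lambda>\<phi>. matrix_of scale bs \<phi> $$ (i, j)) \<in> regular V X"
  unfolding regular_iff'
  by (rule bexI[of _ "\<lambda>\<phi>. matrix_of scale bs \<phi> $$ (i, j)"], simp add: matrix_of_restrict[OF assms(1)],
      rule generated_algebra.incl)
    (use assms in \<open>auto simp: GL_generators_def\<close>)

lemma regular_inverse_det:
  assumes "ordered_basis scale V bs"
  shows "(\<lambda>\<phi>. inverse (det (matrix_of scale bs \<phi>))) \<in> regular V X"
  unfolding regular_iff'
  by (rule bexI[of _ "\<lambda>\<phi>. inverse (det (matrix_of scale bs \<phi>))"], simp add: matrix_of_restrict[OF assms(1)],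
      rule generated_algebra.incl)
    (use assms in \<open>auto simp: GL_generators_def\<close>)

context
  fixes vs and r :: nat and \<Psi> :: "(nat \<Rightarrow> 'k) \<Rightarrow> 'a \<Rightarrow> 'a" and w :: "nat \<Rightarrow> nat \<Rightarrow> int"
  assumes vs: "ordered_basis scale V vs"
    and \<Psi>: "\<And>t. t \<in> torus_points r \<Longrightarrow> \<Psi> t \<in> X"
    and diagonal: "\<And>t j. t \<in> torus_points r \<Longrightarrow> j < length vs \<Longrightarrow>
      \<Psi> t (vs ! j) = scale (laurent_monomial r (w j) t) (vs ! j)"
begin

text \<open>By change of basis, matrix entries of \<open>\<Psi> t\<close> are combinations of the
  weight monomials, and inverse determinants are determinants of the inverse, whose weights are the
  \<open>- w j\<close>. With all exponents for \<open>W\<close> this shows that a parametrization is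
  a morphism; with the lattice of weights it bounds which characters can be pullbacks.\<close>

lemma regular_pullback:
  assumes W: "0 \<in> W" "\<And>e h. e \<in> W \<Longrightarrow> h \<in> W \<Longrightarrow> e + h \<in> W"
    and w: "\<And>j. j < length vs \<Longrightarrow> w j \<in> W" "\<And>j. j < length vs \<Longrightarrow> - w j \<in> W"
    and f: "f \<in> regular V X"
  shows "(\<lambda>t. f (\<Psi> t)) \<in> laurent_span r W"
proof -
  note \<Psi>' = subsetD[OF X(1) \<Psi>]
  \<comment> \<open>Stated for arbitrary \<open>\<Phi>\<close> and \<open>u\<close> because it is
    applied both to \<open>\<Psi>\<close> with weights \<open>w\<close> and to its inverse with
    weights \<open>- w\<close>.\<close>
  have entry: "(\<lambda>t. matrix_of scale bs (\<Phi> t) $$ (i, j)) \<in> laurent_span r W"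
    if bs: "ordered_basis scale V bs" and ij: "i < length bs" "j < length bs"
      and \<Phi>: "\<And>t. t \<in> torus_points r \<Longrightarrow> \<Phi> t \<in> algebra_automorphisms scale"
      and d: "\<And>t j. t \<in> torus_points r \<Longrightarrow> j < length vs \<Longrightarrow>
        \<Phi> t (vs ! j) = scale (laurent_monomial r (u j) t) (vs ! j)"
      and u: "\<And>j. j < length vs \<Longrightarrow> u j \<in> W"
    for bs i j \<Phi> u
  proof -
    let ?a = "\<lambda>k. representation (set vs) (bs ! j) (vs ! k) * representation (set bs) (vs ! k) (bs ! i)"
    have "(\<lambda>t. \<Sum>k<length vs. ?a k * laurent_monomial r (u k) t) \<in> laurent_span r W"
      by (rule laurent_span_sum, rule laurent_span_monomial) (use u in auto)
    then show ?thesis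
    proof (rule laurent_span_cong)
      fix t :: "nat \<Rightarrow> 'k" assume t: "t \<in> torus_points r"
      have "\<Phi> t (bs ! j) = (\<Sum>k<length vs. scale (representation (set vs) (bs ! j) (vs ! k) * laurent_monomial r (u k) t) (vs ! k))"
        by (subst automorphism_basis_image[OF vs \<Phi>[OF t] ordered_basis_nth[OF bs ij(2)]])
          (auto simp: d[OF t])
      then show "matrix_of scale bs (\<Phi> t) $$ (i, j) = (\<Sum>k<length vs. ?a k * laurent_monomial r (u k) t)"
        using ij ordered_basis_nth[OF vs]
        by (simp add: matrix_of_nth, subst representation_sum_ordered_basis[OF bs]) (auto simp: mult_ac)
    qed
  qed
  obtain g where g: "g \<in> generated_algebra (\<lambda>c g x. c * g x) (GL_generators V)"
    "\<forall>\<phi>\<in>X. f \<phi> = g (restrict \<phi> V)"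
    using f unfolding regular_iff' by blast
  from g(1) have "(\<lambda>t. g (restrict (\<Psi> t) V)) \<in> laurent_span r W"
  proof induction
    case (incl g)
    then consider bs i j where "ordered_basis scale V bs" "i < length bs" "j < length bs"
        "g = (\<lambda>\<phi>. matrix_of scale bs \<phi> $$ (i, j))"
      | bs where "ordered_basis scale V bs" "g = (\<lambda>\<phi>. inverse (det (matrix_of scale bs \<phi>)))"
      unfolding GL_generators_def by blast
    then show ?case
    proof cases
      case 1
      then show ?thesis
        using entry[OF 1(1-3) \<Psi>' diagonal w(1)] by (simp only: matrix_of_restrict[OF 1(1)])
    next
      case (2 bs)
      have inv_diagonal: "inv_into UNIV (\<Psi> t) (vs ! j) = scale (laurent_monomial r (- w j) t) (vs ! j)"
        if t: "t \<in> torus_points r" and j: "j < length vs" for t j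
      proof (rule inv_into_f_eq)
        show "inj (\<Psi> t)" using automorphismD(1)[OF \<Psi>'[OF t]] by (simp add: bij_def)
        show "\<Psi> t (scale (laurent_monomial r (- w j) t) (vs ! j)) = vs ! j"
          using laurent_monomial_nonzero[OF t, of "w j"]
          by (simp add: automorphismD(3)[OF \<Psi>'[OF t]] diagonal[OF t j] laurent_monomial_uminus)
      qed simp
      have "(\<lambda>t. det (matrix_of scale bs (inv_into UNIV (\<Psi> t)))) \<in> laurent_span r W"
        unfolding det_def'[OF matrix_of_dim(1)]
        by (rule laurent_span_sum, rule laurent_span_mult[OF laurent_span_const laurent_span_prod])
          (auto intro!: W entry[OF 2(1) _ _ automorphism_inv[OF \<Psi>'] inv_diagonal w(2)]
            simp: permutes_in_image)
      then show ?thesis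
        by (rule laurent_span_cong)
          (simp only: 2(2) matrix_of_restrict[OF 2(1)] inverse_det_matrix_of[OF 2(1) \<Psi>' X(2)[OF \<Psi>]])
    qed
  next
    case one
    then show ?case using laurent_span_const[OF W(1), of 1 r] by simp
  next
    case (add f g)
    then show ?case using laurent_span_add by fastforce
  next
    case (mult f g)
    then show ?case using laurent_span_mult[OF _ _ W(2)] by fastforce
  next
    case (scale g c)
    then show ?case using laurent_span_mult[OF laurent_span_const[OF W(1)] _ W(2)] by fastforce
  qed
  then show ?thesis
    by (rule laurent_span_cong) (use g(2) \<Psi> in auto)
qed

end

end

end

section \<open>Diagonal tori\<close>

context unital_algebra
begin

lemma coord_induced:
  assumes "T \<subseteq> X"
  shows "coord (induced_group (restriction_group scale V X) T) = regular V T"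
  unfolding induced_group_def restriction_group_def regular_def using assms
  by (auto simp: subset_iff)

text \<open>The structure induced on \<open>T\<close> is independent of the surrounding group of
  automorphisms. Hence an isomorphism with a standard torus carries over between the graded and the
  filtered group, and only closedness has to be compared.\<close>

lemma induced_restriction_group:
  assumes "T \<subseteq> X"
  shows "induced_group (restriction_group scale V X) T = restriction_group scale V T"
  using coord_induced[OF assms, of V]
  by (auto simp: induced_group_def restriction_group_def regular_def)

lemma regular_mono: "T \<subseteq> X \<Longrightarrow> f \<in> regular V X \<Longrightarrow> f \<in> regular V T"
  by (auto simp: regular_def restriction_group_def)

text \<open>The matrix \<open>a\<close> is an integer left inverse of the weight matrix, so the
  \<open>i\<close>-th coordinate of \<open>t\<close> is the monomial with exponents
  \<open>a i\<close> in the eigenvalues of \<open>\<Psi> t\<close>. This makes the inverse of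
  \<open>\<Psi>\<close> regular. The image is cut out by diagonality and monomial relations among
  eigenvalues, and any solution of them has its parameters in the field itself.\<close>

lemma diagonal_torus:
  fixes vs :: "'a list" and a w :: "nat \<Rightarrow> nat \<Rightarrow> int"
  assumes V: "subspace V" "generated_algebra scale V = UNIV" "\<And>\<phi>. \<phi> \<in> stabilizer C \<Longrightarrow> \<phi> ` V = V"
    and vs: "ordered_basis scale V vs"
    and \<Psi>: "\<And>t. t \<in> torus_points r \<Longrightarrow> \<Psi> t \<in> stabilizer C"
    and diagonal: "\<And>t j. t \<in> torus_points r \<Longrightarrow> j < length vs \<Longrightarrow>
      \<Psi> t (vs ! j) = scale (laurent_monomial r (w j) t) (vs ! j)"
    and w: "\<And>j. j < length vs \<Longrightarrow> w j \<in> exponents r"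
    and a: "\<And>i i'. i < r \<Longrightarrow> i' < r \<Longrightarrow> (\<Sum>j<length vs. a i j * w j i') = (if i = i' then 1 else 0)"
  shows "is_torus (restriction_group scale V (stabilizer C)) (\<Psi> ` torus_points r)"
proof -
  define n where "n = length vs"
  let ?X = "stabilizer C" and ?P = "torus_points r :: (nat \<Rightarrow> 'k) set"
  let ?T = "\<Psi> ` ?P" and ?M = "matrix_of scale vs"
  have X: "?X \<subseteq> algebra_automorphisms scale" by (auto simp: stabilizer_def)
  have aut: "\<Psi> t \<in> algebra_automorphisms scale" if "t \<in> ?P" for t
    using X \<Psi>[OF that] by auto
  have gen: "generated_algebra scale (span (set vs)) = UNIV"
    using V(2) ordered_basisD(3)[OF vs] by simp
  have eqI: "\<phi> = \<psi>" if "\<phi> \<in> algebra_automorphisms scale" "\<psi> \<in> algebra_automorphisms scale"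
      "\<And>j. j < n \<Longrightarrow> \<phi> (vs ! j) = \<psi> (vs ! j)" for \<phi> \<psi>
    by (rule automorphism_eqI[OF that(1,2) gen]) (use that(3) in \<open>auto simp: in_set_conv_nth n_def\<close>)
  have mult: "\<Psi> (torus_mult r s t) = \<Psi> s \<circ> \<Psi> t" if "s \<in> ?P" "t \<in> ?P" for s t
    by (rule eqI) (use that in \<open>auto simp: aut automorphism_comp diagonal n_def
        automorphismD(3)[OF aut] laurent_monomial_mult mult.commute\<close>)
  have one: "\<Psi> (torus_one r) = id"
    by (rule eqI) (auto simp: aut automorphism_id diagonal n_def)
  have inv: "inv_into UNIV (\<Psi> t) = \<Psi> (torus_inv r t)" if "t \<in> ?P" for t
  proof -
    have "\<Psi> t \<circ> \<Psi> (torus_inv r t) = id"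
      using that mult[of t "torus_inv r t"] one by (simp add: torus_mult_inv)
    then have "inv_into UNIV (\<Psi> t) (\<Psi> t (\<Psi> (torus_inv r t) x)) = inv_into UNIV (\<Psi> t) x" for x
      by (simp add: fun_eq_iff)
    then show ?thesis
      using automorphismD(1)[OF aut[OF that]] by (auto simp: fun_eq_iff bij_def)
  qed
  have subgroup: "subgroup ?T (restriction_group scale V ?X)"
    unfolding subgroup_stabilizer_iff
  proof (intro conjI ballI)
    show "id \<in> ?T" using one by (metis imageI torus_closed(1))
    show "\<phi> \<circ> \<psi> \<in> ?T" if "\<phi> \<in> ?T" "\<psi> \<in> ?T" for \<phi> \<psi>
      using that mult by (metis (no_types, opaque_lifting) imageE imageI torus_closed(2))
  qed (use \<Psi> inv in auto)

  text \<open>\<open>y k\<close> is a regular function that inverts the \<open>k\<close>-th diagonal entry of diagonal matrices.\<close>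
  define x where "x k \<phi> = ?M \<phi> $$ (k, k)" for k \<phi>
  define y where "y k \<phi> = inverse (det (?M \<phi>)) * (\<Prod>l\<in>{..<n} - {k}. x l \<phi>)" for k \<phi>
  \<comment> \<open>A regular function on the whole group that restricts to the Laurent monomial
    with exponents \<open>b\<close> in the diagonal entries on diagonal automorphisms; negative
    powers go through \<open>y\<close>.\<close>
  define m where "m b \<phi> = (\<Prod>k<n. if b k \<ge> 0 then x k \<phi> ^ nat (b k) else y k \<phi> ^ nat (- b k))"
    for b :: "nat \<Rightarrow> int" and \<phi>
  have x_reg: "x k \<in> regular V ?X" if "k < n" for k
    unfolding x_def using that by (intro regular_entry[OF V(1) X V(3) vs]) (auto simp: n_def)
  have y_reg: "y k \<in> regular V ?X" for k
    unfolding y_def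
    by (intro regular_mult[OF V(1) X V(3)] regular_inverse_det[OF V(1) X V(3) vs]
        regular_prod[OF V(1) X V(3)] x_reg) auto
  have "(\<lambda>\<phi>. if b k \<ge> 0 then x k \<phi> ^ nat (b k) else y k \<phi> ^ nat (- b k)) \<in> regular V ?X"
    if "k < n" for b :: "nat \<Rightarrow> int" and k
    using regular_power[OF V(1) X V(3) x_reg[OF that], of "nat (b k)"]
      regular_power[OF V(1) X V(3) y_reg[of k], of "nat (- b k)"]
    by (cases "b k \<ge> 0") simp_all
  then have m_reg: "m b \<in> regular V ?X" for b
    unfolding m_def by (intro regular_prod[OF V(1) X V(3)]) auto
  have diag: "\<phi> (vs ! j) = scale (x j \<phi>) (vs ! j) \<and> x j \<phi> \<noteq> 0 \<and> y j \<phi> = inverse (x j \<phi>)"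
    if \<phi>: "\<phi> \<in> ?X" and off: "\<And>i j. i < n \<Longrightarrow> j < n \<Longrightarrow> i \<noteq> j \<Longrightarrow> ?M \<phi> $$ (i, j) = 0" and j: "j < n" for \<phi> j
  proof -
    have \<phi>': "\<phi> \<in> algebra_automorphisms scale" using X \<phi> by auto
    have act: "\<phi> (vs ! j) = scale (x j \<phi>) (vs ! j)" if "j < n" for j
    proof -
      have "\<phi> (vs ! j) \<in> V"
        using V(3)[OF \<phi>] ordered_basis_nth[OF vs] that by (auto simp: n_def)
      then have "\<phi> (vs ! j) = (\<Sum>k<n. scale (?M \<phi> $$ (k, j)) (vs ! k))"
        using ordered_basis_expand[OF vs] that by (simp add: n_def matrix_of_nth)
      also have "\<dots> = (\<Sum>k<n. if k = j then scale (x j \<phi>) (vs ! j) else 0)"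
        by (rule sum.cong) (use off that in \<open>auto simp: x_def\<close>)
      finally show ?thesis using that by simp
    qed
    have nz: "x j \<phi> \<noteq> 0" if "j < n" for j
    proof
      assume "x j \<phi> = 0"
      then have "\<phi> (vs ! j) = \<phi> 0" using act[OF that] automorphismD(6)[OF \<phi>'] by simp
      then have "vs ! j = 0" using automorphismD(1)[OF \<phi>'] by (simp add: bij_def inj_eq)
      then show False
        using ordered_basisD(2)[OF vs] that dependent_zero by (metis n_def nth_mem)
    qed
    have "det (?M \<phi>) = (\<Prod>k<n. x k \<phi>)"
      using off by (subst det_lower_triangular[of n])
        (auto simp: n_def prod_list_diag_prod x_def lessThan_atLeast0)
    also have "\<dots> = x j \<phi> * (\<Prod>l\<in>{..<n} - {j}. x l \<phi>)"
      using j by (simp add: prod.remove)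
    finally have "y j \<phi> = inverse (x j \<phi>)"
      using nz by (simp add: y_def)
    then show ?thesis using act nz j by blast
  qed
  have m_diag: "m b \<phi> = (\<Prod>k<n. x k \<phi> powi b k)"
    if "\<phi> \<in> ?X" "\<And>i j. i < n \<Longrightarrow> j < n \<Longrightarrow> i \<noteq> j \<Longrightarrow> ?M \<phi> $$ (i, j) = 0" for \<phi> b
    unfolding m_def by (rule prod.cong) (use diag[OF that] in \<open>auto simp: power_int_def\<close>)
  have \<Psi>_entry: "?M (\<Psi> t) $$ (i, j) = (if i = j then laurent_monomial r (w j) t else 0)"
    if "t \<in> ?P" "i < n" "j < n" for t i j
    using that ordered_basisD[OF vs] diagonal[of t j] nth_eq_iff_index_eq[of vs i j]
    by (auto simp: n_def matrix_of_nth representation_scale span_base representation_basis)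
  have \<Psi>_x: "x j (\<Psi> t) = laurent_monomial r (w j) t" if "t \<in> ?P" "j < n" for t j
    using \<Psi>_entry[OF that(1,2,2)] by (simp add: x_def)
  \<comment> \<open>Composing monomial maps multiplies exponent matrices. The bounds
    \<open>n\<close> and \<open>r\<close> are rebound because the second use exchanges their
    roles.\<close>
  have swap: "(\<Prod>k<n. (\<Prod>i<r. s i powi c k i) powi b k) = (\<Prod>i<r. s i powi (\<Sum>k<n. c k i * b k))"
    if "\<And>i. i < r \<Longrightarrow> s i \<noteq> 0" for s :: "nat \<Rightarrow> 'k" and c :: "nat \<Rightarrow> nat \<Rightarrow> int" and b and n r :: nat
  proof -
    have "(\<Prod>k<n. (\<Prod>i<r. s i powi c k i) powi b k) = (\<Prod>k<n. \<Prod>i<r. s i powi (c k i * b k))"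
      by (simp add: powi_prod power_int_mult)
    also have "\<dots> = (\<Prod>i<r. \<Prod>k<n. s i powi (c k i * b k))"
      by (rule prod.swap)
    also have "\<dots> = (\<Prod>i<r. s i powi (\<Sum>k<n. c k i * b k))"
      by (rule prod.cong) (use that in \<open>auto simp: powi_sum\<close>)
    finally show ?thesis .
  qed
  have m_\<Psi>: "m b (\<Psi> t) = (\<Prod>i<r. t i powi (\<Sum>k<n. w k i * b k))" if t: "t \<in> ?P" for b t
  proof -
    have "m b (\<Psi> t) = (\<Prod>k<n. laurent_monomial r (w k) t powi b k)"
      using t \<Psi>_entry by (subst m_diag) (auto simp: \<Psi> \<Psi>_x)
    then show ?thesis
      unfolding laurent_monomial_def using swap[of r t w b n] torus_points_nonzero[OF t] by simp
  qed
  \<comment> \<open>The row vector \<open>e\<close> times \<open>a\<close>: the exponents on the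
    eigenvalues that reproduce the character \<open>e\<close> of the torus.\<close>
  define c where "c e k = (\<Sum>i<r. a i k * e i)" for e :: "nat \<Rightarrow> int" and k
  have c: "(\<Sum>k<n. w k i' * c e k) = e i'" if "i' < r" for e i'
  proof -
    have "(\<Sum>k<n. w k i' * c e k) = (\<Sum>k<n. \<Sum>i<r. (a i k * w k i') * e i)"
      by (simp add: c_def sum_distrib_left mult_ac)
    also have "\<dots> = (\<Sum>i<r. (\<Sum>k<n. a i k * w k i') * e i)"
      by (subst sum.swap) (simp add: sum_distrib_right)
    also have "\<dots> = (\<Sum>i<r. if i = i' then e i else 0)"
      by (rule sum.cong) (use a that in \<open>auto simp: n_def\<close>)
    finally show ?thesis using that by simp
  qed
  have m_c: "m (c e) (\<Psi> t) = laurent_monomial r e t" if "t \<in> ?P" for e t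
    using that by (auto simp: m_\<Psi> laurent_monomial_def c)

  have inj: "inj_on \<Psi> ?P"
  proof (rule inj_onI, rule torus_points_eqI)
    fix s t i assume st: "s \<in> ?P" "t \<in> ?P" "\<Psi> s = \<Psi> t" and i: "i < r"
    have "laurent_monomial r (\<lambda>j. if j = i then 1 else 0) u = u i" for u :: "nat \<Rightarrow> 'k"
    proof -
      have "laurent_monomial r (\<lambda>j. if j = i then 1 else 0) u = (\<Prod>j<r. if j = i then u j else 1)"
        unfolding laurent_monomial_def by (intro prod.cong) auto
      then show ?thesis using i by simp
    qed
    then show "s i = t i" using m_c[OF st(1)] m_c[OF st(2)] st(3) by metis
  qed

  \<comment> \<open>Besides diagonality, each eigenvalue must equal the character \<open>w j\<close>
    evaluated at the parameters that \<open>a\<close> reconstructs from all eigenvalues.\<close>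
  define S where "S = {\<lambda>\<phi>. ?M \<phi> $$ (i, j) | i j. i < n \<and> j < n \<and> i \<noteq> j} \<union>
     {\<lambda>\<phi>. m (c (w j)) \<phi> - x j \<phi> | j. j < n}"
  have S_reg: "S \<subseteq> regular V ?X"
    unfolding S_def
    by (auto intro!: regular_diff[OF V(1) X V(3)] m_reg x_reg regular_entry[OF V(1) X V(3) vs] simp: n_def)
  have "?T = {\<phi> \<in> ?X. \<forall>f\<in>S. f \<phi> = 0}"
  proof (intro equalityI subsetI)
    fix \<phi> assume "\<phi> \<in> ?T"
    then obtain t where t: "t \<in> ?P" "\<phi> = \<Psi> t" by auto
    then show "\<phi> \<in> {\<phi> \<in> ?X. \<forall>f\<in>S. f \<phi> = 0}"
      by (auto simp: S_def \<Psi> \<Psi>_entry \<Psi>_x m_c)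
  next
    fix \<phi> assume \<phi>: "\<phi> \<in> {\<phi> \<in> ?X. \<forall>f\<in>S. f \<phi> = 0}"
    then have zero: "\<And>f. f \<in> S \<Longrightarrow> f \<phi> = 0" by simp
    have off: "?M \<phi> $$ (i, j) = 0" if "i < n" "j < n" "i \<noteq> j" for i j
    proof -
      have "(\<lambda>\<phi>. ?M \<phi> $$ (i, j)) \<in> S"
        unfolding S_def by (rule UnI1, rule CollectI, intro exI conjI, rule refl) (use that in auto)
      then show ?thesis by (rule zero)
    qed
    have x: "x j \<phi> = m (c (w j)) \<phi>" if "j < n" for j
    proof -
      have "(\<lambda>\<phi>. m (c (w j)) \<phi> - x j \<phi>) \<in> S"
        unfolding S_def by (rule UnI2, rule CollectI, intro exI conjI, rule refl) (use that in auto)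
      from zero[OF this] have "m (c (w j)) \<phi> - x j \<phi> = 0" .
      then show ?thesis by simp
    qed
    have \<phi>X: "\<phi> \<in> ?X" using \<phi> by auto
    note d = diag[OF \<phi>X off]
    \<comment> \<open>The parameters read off from the eigenvalues by \<open>a\<close>; the
      equations in \<open>S\<close> say that their weights return the eigenvalues.\<close>
    define t where "t = (\<lambda>i\<in>{..<r}. \<Prod>k<n. x k \<phi> powi a i k)"
    have t: "t \<in> ?P" unfolding t_def using d by (intro restrict_torus_points) auto
    have "laurent_monomial r (w j) t = x j \<phi>" if j: "j < n" for j
    proof -
      have "laurent_monomial r (w j) t = (\<Prod>i<r. (\<Prod>k<n. x k \<phi> powi a i k) powi w j i)"
        by (simp add: laurent_monomial_def t_def)
      also have "\<dots> = (\<Prod>k<n. x k \<phi> powi c (w j) k)"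
        unfolding c_def by (rule swap) (use d in auto)
      also have "\<dots> = x j \<phi>"
        using x[OF j] m_diag[OF \<phi>X off] by simp
      finally show ?thesis .
    qed
    then have "\<phi> = \<Psi> t"
      using \<phi>X X d t by (intro eqI aut) (auto simp: diagonal n_def)
    then show "\<phi> \<in> ?T" using t by auto
  qed
  then have closed: "closed_subgroup ?T (restriction_group scale V ?X)"
    using S_reg subgroup unfolding closed_subgroup_def zariski_closed_def
    by (auto simp: restriction_group_simps regular_def)

  define \<theta> where "\<theta> = inv_into ?P \<Psi>"
  have \<theta>: "\<theta> (\<Psi> t) = t" if "t \<in> ?P" for t
    unfolding \<theta>_def using inj that by simp
  have T_sub: "?T \<subseteq> ?X" using \<Psi> by auto
  have bij: "bij_betw \<theta> ?T ?P"
    unfolding \<theta>_def using inj by (intro bij_betw_inv_into) (simp add: bij_betw_def)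
  have inv_\<theta>: "inv_into ?T \<theta> t = \<Psi> t" if "t \<in> ?P" for t
    using bij that \<theta> by (metis bij_betw_def imageI inv_into_f_f)
  have "\<theta> \<in> algebraic_iso (restriction_group scale V ?T) (standard_torus r)"
    unfolding algebraic_iso_def
  proof (intro CollectI conjI ballI)
    show "\<theta> \<in> iso (restriction_group scale V ?T) (standard_torus r)"
      using bij by (auto simp: iso_def hom_def restriction_group_simps standard_torus_simps
          mult[symmetric] \<theta>)
  next
    fix f :: "(nat \<Rightarrow> 'k) \<Rightarrow> 'k" assume "f \<in> coord (standard_torus r)"
    then obtain F b where F: "\<And>t. t \<in> ?P \<Longrightarrow> f t = (\<Sum>e\<in>F. b e * laurent_monomial r e t)"
      unfolding coord_standard_torus laurent_span_def by auto
    have "(\<lambda>\<phi>. \<Sum>e\<in>F. b e * m (c e) \<phi>) \<in> regular V ?X"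
      by (intro regular_sum[OF V(1) X V(3)] regular_mult[OF V(1) X V(3)] regular_const[OF V(1) X V(3)] m_reg)
    then have "(\<lambda>\<phi>. \<Sum>e\<in>F. b e * m (c e) \<phi>) \<in> regular V ?T"
      by (rule regular_mono[OF T_sub])
    then have "f \<circ> \<theta> \<in> regular V ?T"
      unfolding regular_def restriction_group_def by (auto simp: \<theta> F m_c)
    then show "f \<circ> \<theta> \<in> coord (restriction_group scale V ?T)"
      by (simp add: regular_def)
  next
    fix f assume "f \<in> coord (restriction_group scale V ?T)"
    then have f: "f \<in> regular V ?T" by (simp add: regular_def)
    have "(\<lambda>t. f (\<Psi> t)) \<in> laurent_span r (exponents r)"
      by (rule regular_pullback[OF V(1) _ _ vs _ diagonal _ _ _ _ f])
        (use T_sub X V(3) w exponents_closed in \<open>auto simp: exponents_def subset_iff\<close>)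
    then show "f \<circ> inv_into (carrier (restriction_group scale V ?T)) \<theta> \<in> coord (standard_torus r)"
      unfolding coord_standard_torus restriction_group_simps
      by (rule laurent_span_cong) (simp add: inv_\<theta>)
  qed
  then show ?thesis
    unfolding is_torus_def using closed induced_restriction_group[OF T_sub, of V] by auto
qed

end

section \<open>Weight bases\<close>

text \<open>The coefficients \<open>u\<close> are kept besides the divisor \<open>m\<close>, since
  they will supply the last row of a left inverse. The case \<open>m = 0\<close> means that all
  \<open>k j\<close> with \<open>j < n\<close> vanish.\<close>

lemma bezout_family:
  fixes k :: "nat \<Rightarrow> int"
  shows "\<exists>m u. (\<forall>j<n. m dvd k j) \<and> m = (\<Sum>j<n. u j * k j)"
proof (induction n)
  case (Suc n)
  then obtain m u where m: "\<forall>j<n. m dvd k j" "m = (\<Sum>j<n. u j * k j)" by blast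
  obtain x y where xy: "x * m + y * k n = gcd m (k n)" using bezout_int by blast
  let ?u = "\<lambda>j. if j < n then x * u j else y"
  have "(\<Sum>j<Suc n. ?u j * k j) = x * (\<Sum>j<n. u j * k j) + y * k n"
    by (simp add: sum_distrib_left mult.assoc)
  then have "gcd m (k n) = (\<Sum>j<Suc n. ?u j * k j)" using m(2) xy by simp
  moreover have "gcd m (k n) dvd k j" if "j < Suc n" for j
  proof (cases "j = n")
    case False
    with that m(1) have "m dvd k j" by simp
    then show ?thesis by (rule dvd_trans[OF gcd_dvd1])
  qed simp
  ultimately show ?case by (intro exI[of _ "gcd m (k n)"] exI[of _ ?u]) simp
qed auto

text \<open>Padding coefficients with zeros gives one exponent set for finitely many functions, so
  that vectors of Laurent polynomials can be regrouped by exponent.\<close>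

lemma laurent_span_common:
  assumes "finite I" "\<And>i. i \<in> I \<Longrightarrow> f i \<in> laurent_span r W"
  shows "\<exists>F c. finite F \<and> F \<subseteq> W \<and>
    (\<forall>i\<in>I. \<forall>t\<in>torus_points r. f i t = (\<Sum>e\<in>F. c i e * laurent_monomial r e t))"
proof -
  obtain F c where F: "\<And>i. i \<in> I \<Longrightarrow> finite (F i) \<and> F i \<subseteq> W \<and>
      (\<forall>t\<in>torus_points r. f i t = (\<Sum>e\<in>F i. c i e * laurent_monomial r e t))"
    using assms(2) unfolding laurent_span_def by simp metis
  let ?c = "\<lambda>i e. if e \<in> F i then c i e else 0"
  have fin: "finite (\<Union>i\<in>I. F i)" using assms(1) F by auto
  have "f i t = (\<Sum>e\<in>(\<Union>i\<in>I. F i). ?c i e * laurent_monomial r e t)"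
    if "i \<in> I" "t \<in> torus_points r" for i t
  proof -
    have "f i t = (\<Sum>e\<in>F i. c i e * laurent_monomial r e t)" using F that by blast
    also have "\<dots> = (\<Sum>e\<in>(\<Union>i\<in>I. F i). ?c i e * laurent_monomial r e t)"
      using that fin by (intro sum.mono_neutral_cong_left) auto
    finally show ?thesis .
  qed
  then show ?thesis using fin F by (intro exI[of _ "\<Union>i\<in>I. F i"] exI[of _ ?c]) auto
qed

context unital_algebra
begin

text \<open>\<open>\<psi>\<close> inverts the isomorphism with the standard torus. The last two
  facts are the two halves of that isomorphism on coordinate rings: pullbacks are Laurent
  polynomials, and every character is a pullback.\<close>

lemma torus_parametrization:
  assumes "is_torus (restriction_group scale V (stabilizer C)) T"
  obtains r and \<psi> :: "(nat \<Rightarrow> 'k) \<Rightarrow> 'a \<Rightarrow> 'a"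
  where "\<psi> ` torus_points r = T" "T \<subseteq> stabilizer C"
    "\<And>s t. s \<in> torus_points r \<Longrightarrow> t \<in> torus_points r \<Longrightarrow> \<psi> (torus_mult r s t) = \<psi> s \<circ> \<psi> t"
    "\<psi> (torus_one r) = id"
    "\<And>f. f \<in> regular V T \<Longrightarrow> (\<lambda>t. f (\<psi> t)) \<in> laurent_span r (exponents r)"
    "\<And>e. e \<in> exponents r \<Longrightarrow> \<exists>g\<in>regular V T. \<forall>t\<in>torus_points r. g (\<psi> t) = laurent_monomial r e t"
proof -
  let ?G = "restriction_group scale V (stabilizer C)"
  have T: "T \<subseteq> stabilizer C" and id: "id \<in> T" and comp: "\<And>\<phi> \<psi>. \<phi> \<in> T \<Longrightarrow> \<psi> \<in> T \<Longrightarrow> \<phi> \<circ> \<psi> \<in> T"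
    using assms unfolding is_torus_def closed_subgroup_def subgroup_stabilizer_iff by auto
  obtain r \<theta> where \<theta>: "\<theta> \<in> algebraic_iso (restriction_group scale V T) (standard_torus r)"
    using assms unfolding is_torus_def induced_restriction_group[OF T] by auto
  have bij: "bij_betw \<theta> T (torus_points r)"
    and hom: "\<And>\<phi> \<psi>. \<phi> \<in> T \<Longrightarrow> \<psi> \<in> T \<Longrightarrow> \<theta> (\<phi> \<circ> \<psi>) = torus_mult r (\<theta> \<phi>) (\<theta> \<psi>)"
    and coord: "\<And>f. f \<in> laurent_span r (exponents r) \<Longrightarrow> f \<circ> \<theta> \<in> regular V T"
      "\<And>f. f \<in> regular V T \<Longrightarrow> f \<circ> inv_into T \<theta> \<in> laurent_span r (exponents r)"
    using \<theta> by (auto simp: algebraic_iso_def iso_def hom_def restriction_group_simps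
        standard_torus_simps coord_standard_torus regular_def)
  define \<psi> where "\<psi> = inv_into T \<theta>"
  have \<psi>_in: "\<psi> t \<in> T" and \<theta>\<psi>: "\<theta> (\<psi> t) = t" if "t \<in> torus_points r" for t
    unfolding \<psi>_def using bij that by (auto simp: bij_betw_def inv_into_into f_inv_into_f)
  have \<psi>\<theta>: "\<psi> (\<theta> \<phi>) = \<phi>" if "\<phi> \<in> T" for \<phi>
    unfolding \<psi>_def using bij that by (auto simp: bij_betw_def)
  have inj: "\<phi> = \<phi>'" if "\<theta> \<phi> = \<theta> \<phi>'" "\<phi> \<in> T" "\<phi>' \<in> T" for \<phi> \<phi>'
    using bij that by (auto simp: bij_betw_def inj_on_def)
  have mult: "\<psi> (torus_mult r s t) = \<psi> s \<circ> \<psi> t" if "s \<in> torus_points r" "t \<in> torus_points r" for s t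
    by (rule inj) (use that in \<open>auto simp: hom \<theta>\<psi> \<psi>_in comp\<close>)
  show ?thesis
  proof (rule that[of \<psi> r])
    show "\<psi> ` torus_points r = T"
      unfolding \<psi>_def using bij by (meson bij_betw_def bij_betw_inv_into)
    \<comment> \<open>An injective idempotent map is the identity.\<close>
    have "torus_mult r (torus_one r) (torus_one r) = (torus_one r :: nat \<Rightarrow> 'k)"
      by (auto simp: torus_mult_def torus_one_def)
    then have "\<psi> (torus_one r) \<circ> \<psi> (torus_one r) = \<psi> (torus_one r)"
      using mult[of "torus_one r" "torus_one r"] by simp
    moreover have "inj (\<psi> (torus_one r))"
      using \<psi>_in[of "torus_one r"] T automorphismD(1)[OF stabilizer_automorphism] by (auto simp: bij_def)
    ultimately show "\<psi> (torus_one r) = id"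
      by (auto simp: fun_eq_iff inj_eq)
  next
    fix e assume "e \<in> exponents r"
    then have "(\<lambda>t. 1 * laurent_monomial r e t) \<in> laurent_span r (exponents r)"
      by (rule laurent_span_monomial)
    from coord(1)[OF this]
    show "\<exists>g\<in>regular V T. \<forall>t\<in>torus_points r. g (\<psi> t) = laurent_monomial r e t"
      by (rule rev_bexI) (simp add: \<theta>\<psi>)
  qed (use T mult coord(2) in \<open>auto simp: \<psi>_def comp_def\<close>)
qed

text \<open>The spanning set \<open>Q\<close> is free so that the basis inherits properties of its
  members, such as being homogeneous weight vectors.\<close>

lemma finite_dimensional_ordered_basis:
  assumes "finite S" "V \<subseteq> span S" "subspace V" "Q \<subseteq> V" "V \<subseteq> span Q"
  obtains bs where "ordered_basis scale V bs" "set bs \<subseteq> Q"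
proof -
  obtain B where B: "B \<subseteq> Q" "independent B" "Q \<subseteq> span B"
    using maximal_independent_subset[of Q] by blast
  have "finite B"
    using independent_span_bound[OF assms(1) B(2)] B(1) assms(2,4) by auto
  then obtain bs where bs: "set bs = B" "distinct bs" using finite_distinct_list by blast
  have "span B = V"
  proof
    show "span B \<subseteq> V" using B(1) assms(3,4) by (intro span_minimal) auto
    show "V \<subseteq> span B" using assms(5) B(3) span_minimal[OF B(3) subspace_span] by auto
  qed
  with bs B show ?thesis by (intro that[of bs]) (auto simp: ordered_basis_def)
qed

end

context graded_algebra
begin

lemma component_filtration:
  assumes "x \<in> filtration A d"
  shows "component A x n \<in> A n" "n > d \<Longrightarrow> component A x n = 0"
    "(\<Sum>n\<le>d. component A x n) = x"
proof -
  obtain c where c: "x = (\<Sum>k\<le>d. c k)" "\<forall>k\<le>d. c k \<in> A k"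
    using assms by (auto simp: filtration_def)
  have *: "component A x = (\<lambda>k. if k \<le> d then c k else 0)"
    by (rule component_unique[OF grading_component, of "{..d}"])
      (use c subspace_0[OF subspace_component] in auto)
  show "component A x n \<in> A n" by (rule component(1)[OF grading_component])
  show "n > d \<Longrightarrow> component A x n = 0" "(\<Sum>n\<le>d. component A x n) = x"
    using * c(1) by auto
qed

lemma component_subset_filtration:
  assumes "n \<le> d"
  shows "A n \<subseteq> filtration A d"
proof
  fix x assume x: "x \<in> A n"
  have "x = (\<Sum>k\<le>d. if k = n then x else 0)" using assms by simp
  moreover have "\<forall>k\<le>d. (if k = n then x else 0) \<in> A k"
    using x subspace_0[OF subspace_component] by auto
  ultimately show "x \<in> filtration A d"
    unfolding filtration_def by (intro CollectI exI[of _ "\<lambda>k. if k = n then x else 0"]) auto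
qed

lemma subspace_filtration: "subspace (filtration A d)"
proof (rule subspaceI)
  show "0 \<in> filtration A d"
    using component_subset_filtration[of 0 d] subspace_0[OF subspace_component] by auto
next
  fix x y assume "x \<in> filtration A d" "y \<in> filtration A d"
  then obtain b c where "x = (\<Sum>k\<le>d. b k)" "\<forall>k\<le>d. b k \<in> A k" "y = (\<Sum>k\<le>d. c k)" "\<forall>k\<le>d. c k \<in> A k"
    by (auto simp: filtration_def)
  then show "x + y \<in> filtration A d"
    unfolding filtration_def using subspace_add[OF subspace_component]
    by (intro CollectI exI[of _ "\<lambda>k. b k + c k"]) (auto simp: sum.distrib)
next
  fix a x assume "x \<in> filtration A d"
  then obtain c where "x = (\<Sum>k\<le>d. c k)" "\<forall>k\<le>d. c k \<in> A k"
    by (auto simp: filtration_def)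
  then show "scale a x \<in> filtration A d"
    unfolding filtration_def using subspace_scale[OF subspace_component]
    by (intro CollectI exI[of _ "\<lambda>k. scale a (c k)"]) (auto simp: scale_sum_right)
qed

lemma filtration_finite_dimensional:
  assumes "locally_finite scale A"
  obtains S where "finite S" "filtration A d \<subseteq> span S"
proof -
  obtain S where S: "\<And>n. finite (S n) \<and> span (S n) = A n"
    using assms unfolding locally_finite_def by metis
  have "filtration A d \<subseteq> span (\<Union>n\<le>d. S n)"
  proof
    fix x assume "x \<in> filtration A d"
    then obtain c where c: "x = (\<Sum>k\<le>d. c k)" "\<forall>k\<le>d. c k \<in> A k"
      by (auto simp: filtration_def)
    have "c k \<in> span (\<Union>n\<le>d. S n)" if "k \<le> d" for k
      using c(2) S[of k] span_mono[of "S k" "\<Union>n\<le>d. S n"] that by auto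
    then show "x \<in> span (\<Union>n\<le>d. S n)" unfolding c(1) by (intro span_sum) auto
  qed
  then show ?thesis by (rule that[rotated]) (use S in auto)
qed

text \<open>Because graded automorphisms commute with the projections to the \<open>A n\<close>,
  homogeneous components of a weight vector are again weight vectors.\<close>

lemma component_stabilizer:
  assumes "\<phi> \<in> stabilizer A"
  shows "component A (\<phi> x) n = \<phi> (component A x n)"
proof -
  note D = automorphismD[OF stabilizer_automorphism[OF assms]]
  have "component A (\<phi> x) = (\<lambda>n. \<phi> (component A x n))"
  proof (rule component_unique[OF grading_component component(2)[OF grading_component, of x]])
    show "\<phi> x = (\<Sum>i | component A x i \<noteq> 0. \<phi> (component A x i))"
      using component(3)[OF grading_component, of x] D(8) by metis
    show "\<phi> (component A x i) \<in> A i" for i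
      using assms component(1)[OF grading_component, of x i] by (auto simp: stabilizer_def)
  qed (simp add: D)
  then show ?thesis by simp
qed

lemma stabilizer_filtration_image: "\<phi> \<in> stabilizer A \<Longrightarrow> \<phi> ` filtration A d = filtration A d"
  using stabilizer_filtration by (auto simp: stabilizer_def)

text \<open>Diagonalizability of a split torus, made compatible with the grading. The map sending
  \<open>t\<close> to \<open>\<psi> t b\<close> is a Laurent polynomial with vector coefficients;
  these are weight vectors that sum to \<open>b\<close>, and so are their homogeneous components.
  Such vectors span, and a basis can be chosen among them.\<close>

lemma homogeneous_weight_basis:
  fixes \<psi> :: "(nat \<Rightarrow> 'k) \<Rightarrow> 'a \<Rightarrow> 'a"
  assumes inf: "infinite (UNIV :: 'k set)" and "locally_finite scale A"
    and \<psi>: "\<psi> ` torus_points r = T" "T \<subseteq> stabilizer A"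
    and mult: "\<And>s t. s \<in> torus_points r \<Longrightarrow> t \<in> torus_points r \<Longrightarrow> \<psi> (torus_mult r s t) = \<psi> s \<circ> \<psi> t"
    and one: "\<psi> (torus_one r) = id"
    and reg: "\<And>f. f \<in> regular (filtration A d) T \<Longrightarrow> (\<lambda>t. f (\<psi> t)) \<in> laurent_span r (exponents r)"
  obtains vs deg w where "ordered_basis scale (filtration A d) vs"
    "\<And>j. j < length vs \<Longrightarrow> vs ! j \<in> A (deg j)"
    "\<And>j. j < length vs \<Longrightarrow> w j \<in> exponents r"
    "\<And>t j. t \<in> torus_points r \<Longrightarrow> j < length vs \<Longrightarrow> \<psi> t (vs ! j) = scale (laurent_monomial r (w j) t) (vs ! j)"
proof -
  let ?V = "filtration A d"
  define Q where "Q = {v \<in> ?V. (\<exists>n. v \<in> A n) \<and>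
    (\<exists>e\<in>exponents r. \<forall>t\<in>torus_points r. \<psi> t v = scale (laurent_monomial r e t) v)}"
  have \<psi>_in: "\<psi> t \<in> stabilizer A" if "t \<in> torus_points r" for t
    using \<psi> that by auto
  note D = automorphismD[OF stabilizer_automorphism[OF \<psi>_in]]
  note V = subspace_filtration[of d]
  have TX: "T \<subseteq> algebra_automorphisms scale" "\<And>\<phi>. \<phi> \<in> T \<Longrightarrow> \<phi> ` ?V = ?V"
    using \<psi>(2) stabilizer_filtration_image stabilizer_automorphism by blast+
  obtain S where S: "finite S" "?V \<subseteq> span S"
    using filtration_finite_dimensional[OF assms(2)] .
  obtain bs where bs: "ordered_basis scale ?V bs"
    using finite_dimensional_ordered_basis[OF S V subset_refl span_superset] by blast
  have "bs ! j \<in> span Q" if j: "j < length bs" for j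
  proof -
    have "(\<lambda>t. matrix_of scale bs (\<psi> t) $$ (i, j)) \<in> laurent_span r (exponents r)"
      if "i \<in> {..<length bs}" for i
      by (rule reg, rule regular_entry[OF V TX bs]) (use that j in auto)
    then obtain F c where F: "finite F" "F \<subseteq> exponents r"
      "\<And>i t. i < length bs \<Longrightarrow> t \<in> torus_points r \<Longrightarrow>
         matrix_of scale bs (\<psi> t) $$ (i, j) = (\<Sum>e\<in>F. c i e * laurent_monomial r e t)"
      using laurent_span_common[OF finite_lessThan, of "length bs"
          "\<lambda>i t. matrix_of scale bs (\<psi> t) $$ (i, j)" r "exponents r"] by auto
    \<comment> \<open>The vector coefficient of the monomial \<open>e\<close> in
      \<open>\<psi> t (bs ! j)\<close> as a function of \<open>t\<close>.\<close>
    define y where "y e = (\<Sum>i<length bs. scale (c i e) (bs ! i))" for e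
    have y_V: "y e \<in> ?V" for e
      unfolding y_def using ordered_basis_nth[OF bs]
      by (intro subspace_sum[OF V] subspace_scale[OF V]) auto
    have expand: "\<psi> t (bs ! j) = (\<Sum>e\<in>F. scale (laurent_monomial r e t) (y e))"
      if t: "t \<in> torus_points r" for t
    proof -
      have mem: "\<psi> t (bs ! j) \<in> ?V"
        using stabilizer_filtration_image[OF \<psi>_in[OF t], of d] ordered_basis_nth[OF bs j] by auto
      have "\<psi> t (bs ! j) = (\<Sum>i<length bs. scale (\<Sum>e\<in>F. c i e * laurent_monomial r e t) (bs ! i))"
        by (subst ordered_basis_expand[OF bs mem], rule sum.cong)
          (use j F(3)[OF _ t] in \<open>auto simp: matrix_of_nth\<close>)
      also have "\<dots> = (\<Sum>e\<in>F. \<Sum>i<length bs. scale (c i e * laurent_monomial r e t) (bs ! i))"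
        unfolding scale_sum_left by (rule sum.swap)
      finally show ?thesis
        by (simp add: y_def scale_sum_right mult.commute)
    qed
    have weight: "\<psi> s (y e) = scale (laurent_monomial r e s) (y e)"
      if s: "s \<in> torus_points r" and e: "e \<in> F" for s e
    proof -
      \<comment> \<open>With \<open>s\<close> fixed, \<open>\<psi> s (\<psi> t (bs ! j))\<close> is
        expanded in monomials of \<open>t\<close> in two ways, by linearity and by multiplicativity
        of \<open>\<psi>\<close>; coefficients are then compared.\<close>
      have "\<psi> s (y e) - scale (laurent_monomial r e s) (y e) = 0"
      proof (rule laurent_monomials_independent[OF inf F(1,2) _ e,
            where v = "\<lambda>e. \<psi> s (y e) - scale (laurent_monomial r e s) (y e)"])
        fix t :: "nat \<Rightarrow> 'k" assume t: "t \<in> torus_points r"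
        have "\<psi> s (\<psi> t (bs ! j)) = (\<Sum>e\<in>F. scale (laurent_monomial r e t) (\<psi> s (y e)))"
          by (simp add: expand[OF t] D[OF s])
        moreover have "\<psi> s (\<psi> t (bs ! j)) = (\<Sum>e\<in>F. scale (laurent_monomial r e t) (scale (laurent_monomial r e s) (y e)))"
          using mult[OF s t] expand[OF torus_closed(2)[OF s t]]
          by (simp add: fun_eq_iff laurent_monomial_mult mult.commute)
        ultimately show "(\<Sum>e\<in>F. scale (laurent_monomial r e t) (\<psi> s (y e) - scale (laurent_monomial r e s) (y e))) = 0"
          by (simp add: scale_right_diff_distrib sum_subtractf)
      qed
      then show ?thesis by simp
    qed
    have Q: "component A (y e) n \<in> Q" if n: "n \<le> d" and e: "e \<in> F" for n e
      unfolding Q_def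
    proof (intro CollectI conjI bexI[of _ e] ballI exI[of _ n])
      show *: "component A (y e) n \<in> A n" by (rule component(1)[OF grading_component])
      show "component A (y e) n \<in> ?V" using * component_subset_filtration[OF n] by auto
      show "\<psi> t (component A (y e) n) = scale (laurent_monomial r e t) (component A (y e) n)"
        if t: "t \<in> torus_points r" for t
        using component_stabilizer[OF \<psi>_in[OF t], of "y e" n] weight[OF t e]
        by (simp add: component_scale[OF grading_component])
      show "e \<in> exponents r" using F(2) e by auto
    qed
    \<comment> \<open>Evaluation at the neutral point, where all monomials are 1.\<close>
    have "bs ! j = (\<Sum>e\<in>F. y e)"
      using expand[OF torus_closed(1)] one by simp
    also have "\<dots> = (\<Sum>e\<in>F. \<Sum>n\<le>d. component A (y e) n)"
      by (simp add: component_filtration(3)[OF y_V])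
    also have "\<dots> \<in> span Q"
      by (rule span_sum, rule span_sum, rule span_base, rule Q) auto
    finally show ?thesis .
  qed
  then have "set bs \<subseteq> span Q" by (auto simp: in_set_conv_nth)
  then have "?V \<subseteq> span Q"
    using ordered_basisD(3)[OF bs] span_minimal[OF _ subspace_span] by metis
  then obtain vs where vs: "ordered_basis scale ?V vs" "set vs \<subseteq> Q"
    using finite_dimensional_ordered_basis[OF S V, of Q] by (auto simp: Q_def)
  have "\<exists>n e. vs ! j \<in> A n \<and> e \<in> exponents r \<and>
      (\<forall>t\<in>torus_points r. \<psi> t (vs ! j) = scale (laurent_monomial r e t) (vs ! j))" if "j < length vs" for j
    using vs(2) that nth_mem[of j vs] unfolding Q_def by blast
  then obtain deg w where "\<And>j. j < length vs \<Longrightarrow> vs ! j \<in> A (deg j) \<and> w j \<in> exponents r \<and>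
      (\<forall>t\<in>torus_points r. \<psi> t (vs ! j) = scale (laurent_monomial r (w j) t) (vs ! j))"
    by metis
  then show ?thesis using vs(1) by (intro that[of vs deg w]) auto
qed

end

section \<open>Degree scalings in maximal tori\<close>

context graded_algebra
begin

text \<open>Pullbacks of regular functions only involve monomials in the lattice \<open>W\<close> of
  the weights, whereas by \<open>lift\<close> every character is such a pullback. So
  \<open>W\<close> contains the unit vectors, and their coefficients form \<open>a\<close>. This is
  the converse of the criterion in \<open>diagonal_torus\<close>.\<close>

lemma weights_generate:
  fixes \<psi> :: "(nat \<Rightarrow> 'k) \<Rightarrow> 'a \<Rightarrow> 'a" and w :: "nat \<Rightarrow> nat \<Rightarrow> int"
  assumes inf: "infinite (UNIV :: 'k set)"
    and \<psi>: "\<psi> ` torus_points r = T" "T \<subseteq> stabilizer A"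
    and lift: "\<And>e. e \<in> exponents r \<Longrightarrow>
      \<exists>g\<in>regular (filtration A d) T. \<forall>t\<in>torus_points r. g (\<psi> t) = laurent_monomial r e t"
    and vs: "ordered_basis scale (filtration A d) vs"
    and w: "\<And>j. j < length vs \<Longrightarrow> w j \<in> exponents r"
    and diagonal: "\<And>t j. t \<in> torus_points r \<Longrightarrow> j < length vs \<Longrightarrow>
      \<psi> t (vs ! j) = scale (laurent_monomial r (w j) t) (vs ! j)"
  obtains a where "\<And>i i'. i < r \<Longrightarrow> i' < r \<Longrightarrow> (\<Sum>j<length vs. a i j * w j i') = (if i = i' then 1 else (0::int))"
proof -
  define W where "W = {\<lambda>i. \<Sum>j<length vs. a j * w j i | a. True}"
  have W: "0 \<in> W" "\<And>e h. e \<in> W \<Longrightarrow> h \<in> W \<Longrightarrow> e + h \<in> W"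
  proof -
    show "0 \<in> W" unfolding W_def by (rule CollectI, rule exI[of _ "\<lambda>_. 0"]) auto
    fix e h assume "e \<in> W" "h \<in> W"
    then obtain a b where "e = (\<lambda>i. \<Sum>j<length vs. a j * w j i)" "h = (\<lambda>i. \<Sum>j<length vs. b j * w j i)"
      unfolding W_def by blast
    then have "e + h = (\<lambda>i. \<Sum>j<length vs. (a j + b j) * w j i)"
      by (auto simp: fun_eq_iff sum.distrib distrib_right)
    then show "e + h \<in> W"
      unfolding W_def by (intro CollectI exI[of _ "\<lambda>j. a j + b j"] conjI TrueI)
  qed
  have W_w: "w j \<in> W" "- w j \<in> W" if "j < length vs" for j
  proof -
    have w_eq: "w j = (\<lambda>i. \<Sum>k<length vs. (if k = j then 1 else 0) * w k i)"
      and w_uminus_eq: "- w j = (\<lambda>i. \<Sum>k<length vs. (if k = j then -1 else 0) * w k i)"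
      using that by (auto simp: fun_eq_iff if_distrib[of "\<lambda>x. x * _"] cong: if_cong)
    show "w j \<in> W"
      unfolding W_def by (intro CollectI exI conjI TrueI) (rule w_eq)
    show "- w j \<in> W"
      unfolding W_def by (intro CollectI exI conjI TrueI) (rule w_uminus_eq)
  qed
  have W_exp: "W \<subseteq> exponents r"
    using w by (auto simp: W_def exponents_def intro!: sum.neutral)
  have "\<exists>a. \<forall>i'<r. (\<Sum>j<length vs. a j * w j i') = (if i = i' then 1 else 0)" if i: "i < r" for i
  proof -
    let ?e = "\<lambda>i'. if i = i' then 1 else 0 :: int"
    have e: "?e \<in> exponents r" using i by (auto simp: exponents_def)
    then obtain g where g: "g \<in> regular (filtration A d) T"
        "\<And>t. t \<in> torus_points r \<Longrightarrow> g (\<psi> t) = laurent_monomial r ?e t"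
      using lift by blast
    have "(\<lambda>t. g (\<psi> t)) \<in> laurent_span r W"
    proof (rule regular_pullback[OF subspace_filtration _ _ vs _ diagonal W W_w g(1)])
      show "T \<subseteq> algebra_automorphisms scale" using \<psi>(2) stabilizer_automorphism by blast
      show "\<phi> ` filtration A d = filtration A d" if "\<phi> \<in> T" for \<phi>
        using \<psi>(2) stabilizer_filtration_image that by blast
    qed (use \<psi>(1) in auto)
    then have "(laurent_monomial r ?e :: (nat \<Rightarrow> 'k) \<Rightarrow> 'k) \<in> laurent_span r W"
      by (rule laurent_span_cong) (simp add: g(2))
    then have "?e \<in> W" by (rule laurent_monomial_in_span_iff[OF inf W_exp e])
    then obtain a where "?e = (\<lambda>i. \<Sum>j<length vs. a j * w j i)" unfolding W_def by blast
    then show ?thesis by (intro exI[of _ a]) (simp add: fun_eq_iff)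
  qed
  then obtain a where "\<And>i i'. i < r \<Longrightarrow> i' < r \<Longrightarrow> (\<Sum>j<length vs. a i j * w j i') = (if i = i' then 1 else (0::int))"
    by metis
  then show ?thesis by (rule that)
qed

text \<open>The subgroup of \<open>\<int>\<^sup>r \<times> \<int>\<close> generated by the pairs (weight, degree) projects onto \<open>\<int>\<^sup>r\<close> with
  kernel \<open>m\<int>\<close>. If \<open>m = 0\<close>, the degree scalings already lie in \<open>T\<close>; otherwise this subgroup is
  free of rank \<open>r + 1\<close>, so that it is the character group of a larger torus.\<close>

lemma degree_scaling_in_maximal_torus:
  assumes inf: "infinite (UNIV :: 'k set)" and fin: "locally_finite scale A"
    and gen: "generated_algebra scale (filtration A d) = UNIV"
    and T: "maximal_torus (restriction_group scale (filtration A d) (stabilizer A)) T"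
    and q: "q \<noteq> 0"
  shows "degree_scaling q \<in> T"
proof -
  let ?V = "filtration A d"
  have torus: "is_torus (restriction_group scale ?V (stabilizer A)) T"
    and maximal: "\<And>T'. is_torus (restriction_group scale ?V (stabilizer A)) T' \<Longrightarrow> T \<subseteq> T' \<Longrightarrow> T' = T"
    using T by (auto simp: maximal_torus_def)
  obtain r and \<psi> :: "(nat \<Rightarrow> 'k) \<Rightarrow> 'a \<Rightarrow> 'a" where \<psi>: "\<psi> ` torus_points r = T" "T \<subseteq> stabilizer A"
    and mult: "\<And>s t. s \<in> torus_points r \<Longrightarrow> t \<in> torus_points r \<Longrightarrow> \<psi> (torus_mult r s t) = \<psi> s \<circ> \<psi> t"
    and one: "\<psi> (torus_one r) = id"
    and reg: "\<And>f. f \<in> regular ?V T \<Longrightarrow> (\<lambda>t. f (\<psi> t)) \<in> laurent_span r (exponents r)"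
    and lift: "\<And>e. e \<in> exponents r \<Longrightarrow> \<exists>g\<in>regular ?V T. \<forall>t\<in>torus_points r. g (\<psi> t) = laurent_monomial r e t"
    by (rule torus_parametrization[OF torus]) blast
  obtain vs deg w where vs: "ordered_basis scale ?V vs"
    and deg: "\<And>j. j < length vs \<Longrightarrow> vs ! j \<in> A (deg j)"
    and w: "\<And>j. j < length vs \<Longrightarrow> w j \<in> exponents r"
    and diagonal: "\<And>t j. t \<in> torus_points r \<Longrightarrow> j < length vs \<Longrightarrow>
      \<psi> t (vs ! j) = scale (laurent_monomial r (w j) t) (vs ! j)"
    by (rule homogeneous_weight_basis[where d = d, OF inf fin \<psi>], erule (1) mult, rule one, erule reg) blast
  obtain a where a: "\<And>i i'. i < r \<Longrightarrow> i' < r \<Longrightarrow> (\<Sum>j<length vs. a i j * w j i') = (if i = i' then 1 else (0::int))"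
    by (rule weights_generate[where d = d, OF inf \<psi>], erule lift, rule vs, erule w, erule (1) diagonal) blast
  define n where "n = length vs"
  note vs_n = deg[folded n_def] and w_n = w[folded n_def] and diagonal_n = diagonal[folded n_def]
    and a_n = a[folded n_def]
  have gen': "generated_algebra scale (span (set vs)) = UNIV"
    using gen ordered_basisD(3)[OF vs] by simp
  have eqI: "\<phi> = \<phi>'" if "\<phi> \<in> algebra_automorphisms scale" "\<phi>' \<in> algebra_automorphisms scale"
      "\<And>j. j < n \<Longrightarrow> \<phi> (vs ! j) = \<phi>' (vs ! j)" for \<phi> \<phi>'
    by (rule automorphism_eqI[OF that(1,2) gen']) (use that(3) in \<open>auto simp: in_set_conv_nth n_def\<close>)
  have \<psi>_aut: "\<psi> t \<in> algebra_automorphisms scale" if "t \<in> torus_points r" for t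
    using \<psi> that stabilizer_automorphism by blast

  \<comment> \<open>The one-parameter subgroup of \<open>T\<close> with exponents \<open>b\<close>
    imitates the degree as far as weights allow: the residual degrees \<open>k\<close> are
    annihilated by \<open>a\<close>.\<close>
  define b where "b i = (\<Sum>j<n. a i j * int (deg j))" for i
  define k where "k j = int (deg j) - (\<Sum>i<r. b i * w j i)" for j
  \<comment> \<open>The factor \<open>c\<close> will be 1, to reproduce the degree up to
    \<open>k j\<close>, or -1, to cancel that part of it.\<close>
  have powi_b: "laurent_monomial r (w j) (\<lambda>i\<in>{..<r}. q powi (c * b i)) = q powi (c * (int (deg j) - k j))"
    if "q \<noteq> 0" for c j and q :: 'k
    using that by (simp add: laurent_monomial_def k_def sum_distrib_left powi_sum power_int_mult[symmetric] mult.assoc)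
  have powi_b_points: "(\<lambda>i\<in>{..<r}. q powi (c * b i)) \<in> torus_points r" if "q \<noteq> 0" for c and q :: 'k
    using that by (intro restrict_torus_points) auto
  \<comment> \<open>The integer combinations of the \<open>k j\<close> are the kernel described
    above: from a combination of pairs (weight, degree), subtracting the combination of rows of
    \<open>a\<close> with the same weight leaves weight 0 and the same combination of the
    \<open>k j\<close>.\<close>
  obtain m u where m: "\<And>j. j < n \<Longrightarrow> m dvd k j" "m = (\<Sum>j<n. u j * k j)"
    using bezout_family[of n k] by blast
  show ?thesis
  proof (cases "m = 0")
    case True
    have "degree_scaling q = \<psi> (\<lambda>i\<in>{..<r}. q powi (1 * b i))"
    proof (rule eqI)
      fix j assume j: "j < n"
      then have "k j = 0" using m(1)[OF j] True by simp
      then show "degree_scaling q (vs ! j) = \<psi> (\<lambda>i\<in>{..<r}. q powi (1 * b i)) (vs ! j)"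
        unfolding diagonal_n[OF powi_b_points[OF q] j] powi_b[OF q]
        using degree_scaling_homogeneous[OF vs_n[OF j]] by simp
    qed (intro degree_scaling_automorphism \<psi>_aut powi_b_points q)+
    then show ?thesis using powi_b_points[OF q] \<psi>(1) by blast
  next
    case False
    define l where "l j = k j div m" for j
    have l: "k j = m * l j" if "j < n" for j using m(1)[OF that] by (simp add: l_def)
    \<comment> \<open>Removing the part imitated inside \<open>T\<close> leaves an automorphism
      acting on \<open>vs ! j\<close> as \<open>q^(k j)\<close>.\<close>
    define \<rho> where "\<rho> q = \<psi> (\<lambda>i\<in>{..<r}. q powi (- 1 * b i)) \<circ> degree_scaling q" for q
    \<comment> \<open>Labelling by \<open>i\<close> instead of \<open>m * i\<close> divides the
      degrees by \<open>m\<close>. In effect this takes an m-th root of the family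
      \<open>\<rho>\<close>.\<close>
    define B where "B i = {x. \<forall>q\<in>UNIV - {0}. \<rho> q x = scale (q powi (m * i)) x}" for i
    have \<rho>_aut: "\<rho> q \<in> algebra_automorphisms scale" if "q \<noteq> 0" for q
      unfolding \<rho>_def
      by (intro automorphism_comp \<psi>_aut powi_b_points degree_scaling_automorphism that)
    have vs_B: "vs ! j \<in> B (l j)" if j: "j < n" for j
    proof -
      have "\<rho> q (vs ! j) = scale (q powi (m * l j)) (vs ! j)" if q: "q \<noteq> 0" for q
      proof -
        have "\<rho> q (vs ! j) = scale (q ^ deg j * q powi (-1 * (int (deg j) - k j))) (vs ! j)"
          unfolding \<rho>_def comp_apply degree_scaling_homogeneous[OF vs_n[OF j]]
            automorphismD(3)[OF \<psi>_aut[OF powi_b_points[OF q]]] diagonal_n[OF powi_b_points[OF q] j] powi_b[OF q]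
          by simp
        also have "q ^ deg j * q powi (-1 * (int (deg j) - k j)) = q powi (m * l j)"
          using q l[OF j] power_int_add[of q "int (deg j)" "-1 * (int (deg j) - k j)"] by simp
        finally show ?thesis .
      qed
      then show ?thesis by (auto simp: B_def)
    qed
    have "grading B"
      unfolding B_def
    proof (rule eigenspace_grading[where f = "(*)" and u = 1 and S = "set vs"])
      fix i j :: int assume "i \<noteq> j"
      then show "\<exists>q\<in>UNIV - {0}. (q :: 'k) powi (m * i) \<noteq> q powi (m * j)"
        using powi_separates[OF inf, of "m * i" "m * j"] False by auto
    next
      fix x assume "x \<in> set vs"
      then obtain j where "j < n" "x = vs ! j" by (auto simp: in_set_conv_nth n_def)
      then show "\<exists>i. \<forall>q\<in>UNIV - {0}. \<rho> q x = scale (q powi (m * i)) x"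
        using vs_B[of j] by (auto simp: B_def)
    qed (use \<rho>_aut gen' in \<open>auto simp: power_int_mult_distrib power_int_add distrib_left\<close>)
    \<comment> \<open>Defined for every nonzero \<open>s\<close>, with
      \<open>\<sigma> (q powi m)\<close> acting on the basis as \<open>\<rho> q\<close>
      does.\<close>
    define \<sigma> where "\<sigma> s = graded_scaling B (\<lambda>i. s powi i)" for s
    have \<sigma>_aut: "\<sigma> s \<in> algebra_automorphisms scale" if "s \<noteq> 0" for s
      unfolding \<sigma>_def by (rule graded_scaling_automorphism[OF \<open>grading B\<close>]) (use that in \<open>auto simp: power_int_add\<close>)
    have \<sigma>_vs: "\<sigma> s (vs ! j) = scale (s powi l j) (vs ! j)" if "j < n" for s j
      unfolding \<sigma>_def by (rule graded_scaling_homogeneous[OF \<open>grading B\<close> vs_B[OF that]])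

    define \<Psi> where "\<Psi> t = \<psi> (restrict t {..<r}) \<circ> \<sigma> (t r)" for t
    define w' where "w' j = (w j)(r := l j)" for j
    define c where "c i = (\<Sum>j<n. u j * w j i)" for i
    \<comment> \<open>A left inverse of the enlarged weight matrix. The old rows annihilate the new
      column \<open>l\<close>; the last row is \<open>u\<close>, which pairs to 1 with
      \<open>l\<close>, minus the combination of old rows that clears its products \<open>c\<close>
      with the old weights.\<close>
    define a' where "a' i j = (if i < r then a i j else u j - (\<Sum>i<r. c i * a i j))" for i j
    have restrict: "restrict t {..<r} \<in> torus_points r" "t r \<noteq> 0" if "t \<in> torus_points (Suc r)" for t :: "nat \<Rightarrow> 'k"
      using torus_points_nonzero[OF that] by (auto intro!: restrict_torus_points)
    have \<Psi>_aut: "\<Psi> t \<in> algebra_automorphisms scale" if "t \<in> torus_points (Suc r)" for t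
      unfolding \<Psi>_def by (intro automorphism_comp \<psi>_aut \<sigma>_aut restrict that)
    have \<Psi>_vs: "\<Psi> t (vs ! j) = scale (laurent_monomial (Suc r) (w' j) t) (vs ! j)"
      if t: "t \<in> torus_points (Suc r)" and j: "j < n" for t j
    proof -
      have "laurent_monomial (Suc r) (w' j) t = laurent_monomial r (w j) (restrict t {..<r}) * t r powi l j"
        by (simp add: laurent_monomial_def w'_def)
      then show ?thesis
        unfolding \<Psi>_def comp_apply \<sigma>_vs[OF j] automorphismD(3)[OF \<psi>_aut[OF restrict(1)[OF t]]]
          diagonal_n[OF restrict(1)[OF t] j] by (simp add: mult.commute)
    qed
    \<comment> \<open>Both \<open>\<Psi> t\<close> and the degree scalings are diagonal in the
      homogeneous basis, hence commute.\<close>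
    have \<Psi>_stab: "\<Psi> t \<in> stabilizer A" if t: "t \<in> torus_points (Suc r)" for t
    proof (rule commutes_degree_scaling[OF inf \<Psi>_aut[OF t]], rule eqI)
      fix q :: 'k and j assume "q \<noteq> 0" and j: "j < n"
      then show "(\<Psi> t \<circ> degree_scaling q) (vs ! j) = (degree_scaling q \<circ> \<Psi> t) (vs ! j)"
        by (simp add: degree_scaling_homogeneous[OF vs_n] \<Psi>_vs[OF t] automorphismD(3)[OF \<Psi>_aut[OF t]]
            automorphismD(3)[OF degree_scaling_automorphism] mult.commute)
    qed (use t in \<open>auto intro: automorphism_comp \<Psi>_aut degree_scaling_automorphism\<close>)
    have al: "(\<Sum>j<n. a i j * l j) = 0" if i: "i < r" for i
    proof -
      have "m * (\<Sum>j<n. a i j * l j) = (\<Sum>j<n. a i j * k j)"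
        by (simp add: sum_distrib_left l mult_ac)
      also have "\<dots> = b i - (\<Sum>j<n. \<Sum>i'<r. b i' * (a i j * w j i'))"
        by (simp add: k_def b_def right_diff_distrib sum_subtractf sum_distrib_left mult_ac)
      also have "(\<Sum>j<n. \<Sum>i'<r. b i' * (a i j * w j i')) = (\<Sum>i'<r. b i' * (\<Sum>j<n. a i j * w j i'))"
        by (subst sum.swap) (simp add: sum_distrib_left)
      also have "\<dots> = (\<Sum>i'<r. if i' = i then b i' else 0)"
        by (rule sum.cong) (use a_n i in auto)
      finally show ?thesis using i False by simp
    qed
    have ul: "(\<Sum>j<n. u j * l j) = 1"
    proof -
      have "m * (\<Sum>j<n. u j * l j) = m * 1"
        unfolding sum_distrib_left using m(2) l by (simp add: mult_ac)
      then show ?thesis using False by simp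
    qed
    have row: "(\<Sum>j<n. (u j - (\<Sum>i<r. c i * a i j)) * f j)
        = (\<Sum>j<n. u j * f j) - (\<Sum>i<r. c i * (\<Sum>j<n. a i j * f j))" for f
    proof -
      have "(\<Sum>j<n. (\<Sum>i<r. c i * a i j) * f j) = (\<Sum>i<r. c i * (\<Sum>j<n. a i j * f j))"
        unfolding sum_distrib_left sum_distrib_right by (subst sum.swap) (simp add: mult.assoc)
      then show ?thesis by (simp add: left_diff_distrib sum_subtractf)
    qed
    have a': "(\<Sum>j<n. a' i j * w' j i') = (if i = i' then 1 else 0)" if "i < Suc r" "i' < Suc r" for i i'
    proof -
      consider "i < r" "i' < r" | "i < r" "i' = r" | "i = r" "i' < r" | "i = r" "i' = r"
        using \<open>i < Suc r\<close> \<open>i' < Suc r\<close> by (auto simp: less_Suc_eq)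
      then show ?thesis
      proof cases
        case 3
        have "(\<Sum>i<r. c i * (\<Sum>j<n. a i j * w j i')) = (\<Sum>i<r. if i = i' then c i else 0)"
          by (rule sum.cong) (use a_n 3 in auto)
        then show ?thesis using 3 by (simp add: a'_def w'_def row) (simp add: c_def)
      qed (simp_all add: a'_def w'_def row a_n al ul)
    qed
    have "is_torus (restriction_group scale ?V (stabilizer A)) (\<Psi> ` torus_points (Suc r))"
    proof (rule diagonal_torus[where a = a' and w = w', OF subspace_filtration gen stabilizer_filtration_image vs \<Psi>_stab])
      show "w' j \<in> exponents (Suc r)" if "j < length vs" for j
        using w[OF that] by (auto simp: exponents_def w'_def)
    qed (use \<Psi>_vs a' in \<open>auto simp: n_def\<close>)
    moreover have "T \<subseteq> \<Psi> ` torus_points (Suc r)"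
    proof
      fix \<phi> assume "\<phi> \<in> T"
      then obtain t where t: "t \<in> torus_points r" "\<phi> = \<psi> t" using \<psi>(1) by auto
      have ext: "t i = undefined" if "\<not> i < r" for i
        using t(1) that by (simp add: torus_points_def PiE_iff extensional_def)
      have r: "restrict (t(r := 1)) {..<r} = t"
        by (rule HOL.ext) (simp add: restrict_def ext)
      \<comment> \<open>The old torus sits at the value 1 of the new coordinate; the update also
        replaces the value \<open>undefined\<close> that \<open>t\<close> has at
        \<open>r\<close>.\<close>
      have t': "t(r := 1) \<in> torus_points (Suc r)"
        using torus_points_nonzero[OF t(1)] ext
        by (auto simp: torus_points_def PiE_iff extensional_def less_Suc_eq)
      have "\<psi> t = \<Psi> (t(r := 1))"
        by (rule eqI[OF \<psi>_aut[OF t(1)] \<Psi>_aut[OF t']]) (simp add: \<Psi>_def r \<sigma>_vs)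
      then show "\<phi> \<in> \<Psi> ` torus_points (Suc r)" using t' t(2) by auto
    qed
    ultimately have "\<Psi> ` torus_points (Suc r) = T" by (rule maximal)
    moreover have "degree_scaling q \<in> \<Psi> ` torus_points (Suc r)"
    proof
      \<comment> \<open>The first coordinates contribute \<open>q^(deg j - k j)\<close> on
        \<open>vs ! j\<close>, the last one \<open>q^(m * l j)\<close>, which is the missing
        \<open>q^(k j)\<close>.\<close>
      let ?t = "\<lambda>i\<in>{..<Suc r}. if i < r then q powi (1 * b i) else q powi m"
      show t: "?t \<in> torus_points (Suc r)" using q by (intro restrict_torus_points) auto
      have r: "restrict ?t {..<r} = (\<lambda>i\<in>{..<r}. q powi (1 * b i))" "?t r = q powi m"
        by (auto simp: fun_eq_iff)
      show "degree_scaling q = \<Psi> ?t"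
      proof (rule eqI)
        fix j assume j: "j < n"
        have "\<Psi> ?t (vs ! j) = scale ((q powi m) powi l j * q powi (1 * (int (deg j) - k j))) (vs ! j)"
          unfolding \<Psi>_def comp_apply r \<sigma>_vs[OF j] automorphismD(3)[OF \<psi>_aut[OF powi_b_points[OF q]]]
            diagonal_n[OF powi_b_points[OF q] j] powi_b[OF q] by simp
        also have "(q powi m) powi l j * q powi (1 * (int (deg j) - k j)) = q ^ deg j"
          using q l[OF j] power_int_add[of q "k j" "int (deg j) - k j"] by (simp add: power_int_mult)
        finally show "degree_scaling q (vs ! j) = \<Psi> ?t (vs ! j)"
          by (simp only: degree_scaling_homogeneous[OF vs_n[OF j]])
      qed (use t \<Psi>_aut q degree_scaling_automorphism in auto)
    qed
    ultimately show ?thesis by simp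
  qed
qed

text \<open>In a homogeneous basis of the generating subspace the condition is that matrix entries
  between different degrees vanish. It makes closed subsets of the graded group closed in the
  filtered one.\<close>

lemma zariski_closed_stabilizer:
  assumes inf: "infinite (UNIV :: 'k set)" and fin: "locally_finite scale A"
    and gen: "generated_algebra scale (filtration A d) = UNIV"
  obtains S where "S \<subseteq> regular (filtration A d) (stabilizer (filtration A))"
    "stabilizer A = {\<phi> \<in> stabilizer (filtration A). \<forall>f\<in>S. f \<phi> = 0}"
proof -
  let ?V = "filtration A d" and ?X = "stabilizer (filtration A)"
  note V = subspace_filtration[of d]
  define Q where "Q = (\<Union>n\<le>d. A n)"
  obtain S0 where S0: "finite S0" "?V \<subseteq> span S0"
    using filtration_finite_dimensional[OF fin] .
  have "Q \<subseteq> ?V" unfolding Q_def using component_subset_filtration by auto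
  moreover have "?V \<subseteq> span Q"
  proof
    fix x assume x: "x \<in> ?V"
    have "(\<Sum>n\<le>d. component A x n) \<in> span Q"
      by (rule span_sum, rule span_base) (use component_filtration(1)[OF x] in \<open>auto simp: Q_def\<close>)
    then show "x \<in> span Q" using component_filtration(3)[OF x] by simp
  qed
  ultimately obtain vs where vs: "ordered_basis scale ?V vs" "set vs \<subseteq> Q"
    by (rule finite_dimensional_ordered_basis[OF S0 V])
  define n where "n = length vs"
  have "\<exists>k. vs ! j \<in> A k" if "j < n" for j
    using vs(2) nth_mem[of j vs] that unfolding Q_def n_def by blast
  then obtain deg where deg: "\<And>j. j < n \<Longrightarrow> vs ! j \<in> A (deg j)" by metis
  let ?M = "matrix_of scale vs"
  define S where "S = {\<lambda>\<phi>. ?M \<phi> $$ (i, j) | i j. i < n \<and> j < n \<and> deg i \<noteq> deg j}"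
  have X: "?X \<subseteq> algebra_automorphisms scale" "\<And>\<phi>. \<phi> \<in> ?X \<Longrightarrow> \<phi> ` ?V = ?V"
    by (auto simp: stabilizer_def)
  have act: "\<phi> (vs ! j) = (\<Sum>i<n. scale (?M \<phi> $$ (i, j)) (vs ! i))" if "\<phi> \<in> ?X" "j < n" for \<phi> j
  proof -
    have "\<phi> (vs ! j) \<in> ?V" using X(2)[OF that(1)] ordered_basis_nth[OF vs(1)] that(2) by (auto simp: n_def)
    then show ?thesis
      using ordered_basis_expand[OF vs(1)] that(2) by (simp add: n_def matrix_of_nth)
  qed
  show ?thesis
  proof (rule that[of S])
    show "S \<subseteq> regular ?V ?X"
      unfolding S_def by (auto intro!: regular_entry[OF V X vs(1)] simp: n_def)
    show "stabilizer A = {\<phi> \<in> ?X. \<forall>f\<in>S. f \<phi> = 0}"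
    proof (intro equalityI subsetI)
      fix \<phi> assume \<phi>: "\<phi> \<in> stabilizer A"
      have "?M \<phi> $$ (i, j) = 0" if ij: "i < n" "j < n" "deg i \<noteq> deg j" for i j
      proof -
        have mem: "\<phi> (vs ! j) \<in> A (deg j)" using \<phi> deg[OF ij(2)] by (auto simp: stabilizer_def)
        define J where "J = {i. i < n \<and> deg i = deg j}"
        have "\<phi> (vs ! j) = component A (\<phi> (vs ! j)) (deg j)"
          by (simp add: component_homogeneous[OF grading_component mem])
        also have "\<dots> = component A (\<Sum>i<n. scale (?M \<phi> $$ (i, j)) (vs ! i)) (deg j)"
          using act[OF stabilizer_filtration[OF \<phi>] ij(2)] by simp
        finally have eq: "\<phi> (vs ! j) = component A (\<Sum>i<n. scale (?M \<phi> $$ (i, j)) (vs ! i)) (deg j)" .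
        have comp: "component A (\<Sum>i\<in>I. scale (g i) (vs ! i)) (deg j)
            = (\<Sum>i\<in>I. scale (if deg i = deg j then g i else 0) (vs ! i))" if "finite I" "I \<subseteq> {..<n}" for I g
          using that
        proof (induction I rule: finite_induct)
          case empty
          show ?case
            using component_homogeneous[OF grading_component subspace_0[OF subspace_component], of "deg j"] by simp
        next
          case (insert i I)
          then show ?case
            using component_homogeneous[OF grading_component deg[of i]]
            by (auto simp: component_add[OF grading_component] component_scale[OF grading_component])
        qed
        have "\<phi> (vs ! j) = (\<Sum>i<n. scale (if deg i = deg j then ?M \<phi> $$ (i, j) else 0) (vs ! i))"
          using eq comp[of "{..<n}" "\<lambda>i. ?M \<phi> $$ (i, j)"] by simp
        then have "?M \<phi> $$ (i, j) = representation (set vs)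
            (\<Sum>i'<n. scale (if deg i' = deg j then ?M \<phi> $$ (i', j) else 0) (vs ! i')) (vs ! i)"
          using ij by (simp add: matrix_of_nth n_def)
        also have "\<dots> = (\<Sum>i'<n. (if deg i' = deg j then ?M \<phi> $$ (i', j) else 0) * representation (set vs) (vs ! i') (vs ! i))"
          by (rule representation_sum_ordered_basis[OF vs(1)]) (use ordered_basis_nth[OF vs(1)] in \<open>auto simp: n_def\<close>)
        also have "\<dots> = 0"
          using ij ordered_basisD[OF vs(1)]
          by (intro sum.neutral) (auto simp: representation_basis n_def nth_eq_iff_index_eq)
        finally show ?thesis .
      qed
      then show "\<phi> \<in> {\<phi> \<in> ?X. \<forall>f\<in>S. f \<phi> = 0}"
        using stabilizer_filtration[OF \<phi>] by (auto simp: S_def)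
    next
      fix \<phi> assume "\<phi> \<in> {\<phi> \<in> ?X. \<forall>f\<in>S. f \<phi> = 0}"
      then have \<phi>: "\<phi> \<in> ?X" and zero: "\<And>f. f \<in> S \<Longrightarrow> f \<phi> = 0" by auto
      have off: "?M \<phi> $$ (i, j) = 0" if "i < n" "j < n" "deg i \<noteq> deg j" for i j
      proof -
        have "(\<lambda>\<phi>. ?M \<phi> $$ (i, j)) \<in> S"
          unfolding S_def by (rule CollectI, intro exI conjI, rule refl) (use that in auto)
        then show ?thesis by (rule zero)
      qed
      have mem: "\<phi> (vs ! j) \<in> A (deg j)" if j: "j < n" for j
        unfolding act[OF \<phi> j]
      proof (rule subspace_sum[OF subspace_component])
        fix i assume "i \<in> {..<n}"
        then show "scale (?M \<phi> $$ (i, j)) (vs ! i) \<in> A (deg j)"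
          using off[of i j] j deg[of i] subspace_scale[OF subspace_component] subspace_0[OF subspace_component]
          by (cases "deg i = deg j") auto
      qed
      have \<phi>': "\<phi> \<in> algebra_automorphisms scale" using X(1) \<phi> by auto
      \<comment> \<open>The equations only concern degrees up to \<open>d\<close>. Commuting with
        the degree scalings spreads from the generating subspace to the whole algebra, and the
        centralizer criterion then covers all degrees.\<close>
      show "\<phi> \<in> stabilizer A"
      proof (rule commutes_degree_scaling[OF inf \<phi>'])
        fix q :: 'k assume q: "q \<noteq> 0"
        show "\<phi> \<circ> degree_scaling q = degree_scaling q \<circ> \<phi>"
        proof (rule automorphism_eqI[of _ _ "set vs"])
          fix x assume "x \<in> set vs"
          then obtain j where j: "j < n" "x = vs ! j" by (auto simp: in_set_conv_nth n_def)
          then show "(\<phi> \<circ> degree_scaling q) x = (degree_scaling q \<circ> \<phi>) x"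
            by (simp add: degree_scaling_homogeneous[OF deg] degree_scaling_homogeneous[OF mem]
                automorphismD(3)[OF \<phi>'])
        qed (use gen ordered_basisD(3)[OF vs(1)] \<phi>' q degree_scaling_automorphism in \<open>auto intro: automorphism_comp\<close>)
      qed
    qed
  qed
qed

end

section \<open>Transfer of tori between the graded and the filtered group\<close>

theorem lemma6p9:
  fixes scale :: "'k::field \<Rightarrow> 'a::{ring, monoid_mult} \<Rightarrow> 'a"
    and A :: "nat \<Rightarrow> 'a set"
    and d :: nat
    and T :: "('a \<Rightarrow> 'a) set"
  assumes "infinite (UNIV :: 'k set)"
    and "graded_algebra scale A"
    and "locally_finite scale A"
    and "affine_algebra scale"
    and "generated_algebra scale (filtration A d) = UNIV"
    and "maximal_torus (Aut_gr scale A d) T"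
  shows "maximal_torus (Aut_fl scale A d) T"
proof -
  interpret graded_algebra scale A by (rule assms(2))
  let ?V = "filtration A d" and ?X = "stabilizer (filtration A)"
  let ?fl = "restriction_group scale ?V ?X" and ?gr = "restriction_group scale ?V (stabilizer A)"
  have T: "maximal_torus ?gr T" using assms(6) by (simp add: Aut_gr_eq)
  have gr_fl: "stabilizer A \<subseteq> ?X" using stabilizer_filtration by auto
  have torus: "is_torus ?gr T"
    and maximal: "\<And>T'. is_torus ?gr T' \<Longrightarrow> T \<subseteq> T' \<Longrightarrow> T' = T"
    using T by (auto simp: maximal_torus_def)
  have T_gr: "T \<subseteq> stabilizer A"
    using torus by (simp add: is_torus_def closed_subgroup_def subgroup_stabilizer_iff)
  obtain S where S: "S \<subseteq> regular ?V ?X" "stabilizer A = {\<phi> \<in> ?X. \<forall>f\<in>S. f \<phi> = 0}"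
    using zariski_closed_stabilizer[OF assms(1,3,5)] .

  have "is_torus ?fl T"
  proof -
    obtain S' where S': "S' \<subseteq> regular ?V (stabilizer A)" "T = {\<phi> \<in> stabilizer A. \<forall>f\<in>S'. f \<phi> = 0}"
      using torus by (auto simp: is_torus_def closed_subgroup_def zariski_closed_def restriction_group_simps regular_def)
    \<comment> \<open>Both coordinate rings are restricted from the same \<open>GL\<close>, so an
      equation on the graded group extends to the filtered one; joined with \<open>S\<close>, the
      extended equations cut out \<open>T\<close> there.\<close>
    have "\<exists>g\<in>regular ?V ?X. \<forall>\<phi>\<in>stabilizer A. g \<phi> = f \<phi>" if "f \<in> S'" for f
    proof -
      have "f \<in> regular ?V (stabilizer A)" using S'(1) that by blast
      then obtain g where "g \<in> coord (GL scale ?V)" "\<forall>\<phi>\<in>stabilizer A. f \<phi> = g (restrict \<phi> ?V)"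
        by (auto simp: regular_def restriction_group_def)
      then show ?thesis
        by (intro bexI[of _ "\<lambda>\<phi>. g (restrict \<phi> ?V)"]) (auto simp: regular_def restriction_group_def)
    qed
    then obtain h where h: "\<And>f. f \<in> S' \<Longrightarrow> h f \<in> regular ?V ?X"
        "\<And>f \<phi>. f \<in> S' \<Longrightarrow> \<phi> \<in> stabilizer A \<Longrightarrow> h f \<phi> = f \<phi>"
      by metis
    have "\<phi> \<in> T \<longleftrightarrow> \<phi> \<in> ?X \<and> (\<forall>f\<in>S \<union> h ` S'. f \<phi> = 0)" for \<phi>
    proof (cases "\<phi> \<in> stabilizer A")
      case True
      then have "\<phi> \<in> ?X" "\<forall>f\<in>S. f \<phi> = 0" "\<phi> \<in> T \<longleftrightarrow> (\<forall>f\<in>S'. f \<phi> = 0)"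
        using S(2) S'(2) by blast+
      then show ?thesis by (simp add: ball_Un h(2) True)
    next
      case False
      then show ?thesis using S(2) T_gr by blast
    qed
    then have "T = {\<phi> \<in> ?X. \<forall>f\<in>S \<union> h ` S'. f \<phi> = 0}" by blast
    then have "zariski_closed ?fl T"
      unfolding zariski_closed_def using S(1) h(1)
      by (intro exI[of _ "S \<union> h ` S'"]) (auto simp: restriction_group_simps regular_def)
    moreover have "subgroup T ?fl"
      using torus gr_fl by (auto simp: is_torus_def closed_subgroup_def subgroup_stabilizer_iff)
    ultimately show ?thesis
      using torus T_gr gr_fl
      by (auto simp: is_torus_def closed_subgroup_def induced_restriction_group)
  qed
  moreover have "T' = T" if T': "is_torus ?fl T'" "T \<subseteq> T'" for T'
  proof -
    obtain r and \<psi> :: "(nat \<Rightarrow> 'k) \<Rightarrow> 'a \<Rightarrow> 'a" where \<psi>: "\<psi> ` torus_points r = T'" "T' \<subseteq> ?X"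
      and mult: "\<And>s t. s \<in> torus_points r \<Longrightarrow> t \<in> torus_points r \<Longrightarrow> \<psi> (torus_mult r s t) = \<psi> s \<circ> \<psi> t"
      by (rule torus_parametrization[OF T'(1)]) blast
    have commute: "\<phi> \<circ> \<phi>' = \<phi>' \<circ> \<phi>" if "\<phi> \<in> T'" "\<phi>' \<in> T'" for \<phi> \<phi>'
    proof -
      obtain s t where st: "s \<in> torus_points r" "t \<in> torus_points r" "\<phi> = \<psi> s" "\<phi>' = \<psi> t"
        using \<psi>(1) \<open>\<phi> \<in> T'\<close> \<open>\<phi>' \<in> T'\<close> by auto
      then show ?thesis using mult[of s t] mult[of t s] by (simp add: torus_mult_commute[of r s t])
    qed
    \<comment> \<open>The degree scalings lie in \<open>T\<close>, hence in the commutative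
      \<open>T'\<close>, so \<open>T'\<close> lies in their centralizer.\<close>
    have T'_gr: "T' \<subseteq> stabilizer A"
    proof
      fix \<phi> assume \<phi>: "\<phi> \<in> T'"
      then have "\<phi> \<in> algebra_automorphisms scale" using \<psi>(2) stabilizer_automorphism by blast
      then show "\<phi> \<in> stabilizer A"
        using commutes_degree_scaling[OF assms(1)] commute[OF \<phi>] T'(2)
          degree_scaling_in_maximal_torus[OF assms(1,3,5) T] by blast
    qed
    obtain S' where S': "S' \<subseteq> regular ?V ?X" "T' = {\<phi> \<in> ?X. \<forall>f\<in>S'. f \<phi> = 0}"
      using T'(1) by (auto simp: is_torus_def closed_subgroup_def zariski_closed_def restriction_group_simps regular_def)
    \<comment> \<open>Now that \<open>T'\<close> is graded, its equations in the filtered group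
      define it in the graded group too, where the maximality of \<open>T\<close> applies.\<close>
    have "T' = {\<phi> \<in> stabilizer A. \<forall>f\<in>S'. f \<phi> = 0}"
      using S'(2) T'_gr gr_fl by auto
    then have "zariski_closed ?gr T'"
      unfolding zariski_closed_def using S'(1) regular_mono[OF gr_fl, of _ ?V]
      by (intro exI[of _ S']) (auto simp: restriction_group_simps regular_def)
    moreover have "subgroup T' ?gr"
      using T'(1) T'_gr by (auto simp: is_torus_def closed_subgroup_def subgroup_stabilizer_iff)
    ultimately have "is_torus ?gr T'"
      using T'(1) T'_gr \<psi>(2)
      by (auto simp: is_torus_def closed_subgroup_def induced_restriction_group)
    then show ?thesis using maximal T'(2) by blast
  qed
  ultimately have "maximal_torus ?fl T" by (auto simp: maximal_torus_def)
  then show ?thesis by (simp add: Aut_fl_eq)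
qed

end
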